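(* Let $p_1,\ldots,p_n\in\mathbb B$ be $n$ distinct points, no three of which belong to the same $2$-sphere, and let $s_1,\ldots,s_n\in\mathbb H$. Assume that the Pick matrix $$P=\left[\sum_{k=0}^\infty p_i^k(1-s_i\bar s_j)\bar p_j^k\right]_{i,j=1}^n$$ is positive semidefinite and singular. Then there is at most one function $S\in\mathcal R(\mathbb B,\overline{\mathbb B})$ such that $S(p_i)=s_i$ for $i=1,\ldots,n$, and this function, if it exists, is given by the formula $$S=R\star Q^{-\star},$$ where $$R=\sum_{i=1}^nk_{\mathrm H^2}(\cdot,p_i)\alpha_i,\qquad Q=\sum_{i:\,s_i\ne0}k_{\mathrm H^2}(\cdot,s_i^{-1}p_is_i)\,\overline{s}_i\alpha_i$$ and where $\mathbf y=[\alpha_1\ \cdots\ \alpha_n]^\top\in\mathbb H^n$ is any nonzero (column) vector such that $P\mathbf y=0$.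
   Context: $\mathbb H$ is the algebra of real quaternions, $\mathbb B=\{p\in\mathbb H:|p|<1\}$, $\overline{\mathbb B}$ its closure, and $\mathbb S$ is the unit sphere of purely imaginary quaternions; for $I\in\mathbb S$, $\mathbb C_I=\{x+Iy:x,y\in\mathbb R\}$. Two quaternions $p,q$ are equivalent if $p=h^{-1}qh$ for some nonzero $h\in\mathbb H$; the equivalence class $[p]$ is called a $2$-sphere. For $\Omega\subset\mathbb H$ open, a real differentiable function $f:\Omega\to\mathbb H$ is (left) slice regular on $\Omega$ if for every $I\in\mathbb S$ its restriction $f_I$ to $\Omega\cap\mathbb C_I$ satisfies $\frac{\partial}{\partial x}f_I(x+Iy)+I\frac{\partial}{\partial y}f_I(x+Iy)\equiv0$. The set $\mathcal R(\mathbb B)$ of functions slice regular on $\mathbb B$ is exactly the set of power series $f(p)=\sum_{k\ge0}p^kf_k$, $f_k\in\mathbb H$, with radius of convergence at least one. $\mathcal R(\mathbb B,\overline{\mathbb B})$ is the set of $f\in\mathcal R(\mathbb B)$ with $|f(p)|\le1$ on $\mathbb B$. For $q\in\mathbb B$, $k_{\mathrm H^2}(p,q)=\sum_{m=0}^\infty p^m\bar q^m$. The $\star$-product of $g(p)=\sum p^kg_k$ and $f(p)=\sum p^kf_k$ is $(g\star f)(p)=\sum_kp^k\bigl(\sum_{r=0}^kg_rf_{k-r}\bigr)$; pointwise, $(g\star f)(p)=g(p)f(g(p)^{-1}pg(p))$ if $g(p)\ne0$ and $(g\star f)(p)=0$ if $g(p)=0$, and this pointwise formula is used when $f$ is not defined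 on all of $\mathbb B$. For $f\in\mathcal R(\mathbb B)$ not identically zero, $f^{-\star}(p)=\bigl((f^c\star f)(p)\bigr)^{-1}f^c(p)$ with $f^c(p)=\sum_kp^k\overline{f_k}$, defined on $\mathbb B$ outside the zeros of $f^c\star f$. The formula $S=R\star Q^{-\star}$ is understood to include that $Q\not\equiv0$, and to hold where $Q^{-\star}$ is defined, its values elsewhere on $\mathbb B$ being obtained by continuity. A Hermitian quaternionic matrix $A$ is positive semidefinite if $c^*Ac\ge0$ for all column vectors $c$ over $\mathbb H$. *)

theory Defs
  imports "HOL-Analysis.Analysis"
begin

section \<open>The real quaternions\<close>

datatype quat = Quat (qRe: real) (qI: real) (qJ: real) (qK: real)

lemma quat_eq_iff: "x = y \<longleftrightarrow> qRe x = qRe y \<and> qI x = qI y \<and> qJ x = qJ y \<and> qK x = qK y"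
  by (cases x; cases y) simp

instantiation quat :: ab_group_add
begin

definition zero_quat where "0 = Quat 0 0 0 0"
definition plus_quat where
  "x + y = Quat (qRe x + qRe y) (qI x + qI y) (qJ x + qJ y) (qK x + qK y)"
definition uminus_quat where "- x = Quat (- qRe x) (- qI x) (- qJ x) (- qK x)"
definition minus_quat where
  "x - y = Quat (qRe x - qRe y) (qI x - qI y) (qJ x - qJ y) (qK x - qK y)"

instance
  by standard (simp_all add: zero_quat_def plus_quat_def uminus_quat_def minus_quat_def)

end

lemma quat_zero_sel [simp]: "qRe 0 = 0" "qI 0 = 0" "qJ 0 = 0" "qK 0 = 0"
  by (simp_all add: zero_quat_def)

lemma quat_add_sel [simp]:
  "qRe (x + y) = qRe x + qRe y" "qI (x + y) = qI x + qI y"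
  "qJ (x + y) = qJ x + qJ y" "qK (x + y) = qK x + qK y"
  by (simp_all add: plus_quat_def)

lemma quat_uminus_sel [simp]:
  "qRe (- x) = - qRe x" "qI (- x) = - qI x" "qJ (- x) = - qJ x" "qK (- x) = - qK x"
  by (simp_all add: uminus_quat_def)

lemma quat_minus_sel [simp]:
  "qRe (x - y) = qRe x - qRe y" "qI (x - y) = qI x - qI y"
  "qJ (x - y) = qJ x - qJ y" "qK (x - y) = qK x - qK y"
  by (simp_all add: minus_quat_def)

instantiation quat :: ring_1
begin

definition one_quat where "1 = Quat 1 0 0 0"

definition times_quat where
  "x * y = Quat
     (qRe x * qRe y - qI x * qI y - qJ x * qJ y - qK x * qK y)
     (qRe x * qI y + qI x * qRe y + qJ x * qK y - qK x * qJ y)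
     (qRe x * qJ y - qI x * qK y + qJ x * qRe y + qK x * qI y)
     (qRe x * qK y + qI x * qJ y - qJ x * qI y + qK x * qRe y)"

instance
proof
  show "(0 :: quat) \<noteq> 1"
    by (simp add: one_quat_def zero_quat_def)
qed (simp_all add: one_quat_def times_quat_def quat_eq_iff algebra_simps)

end

lemma quat_one_sel [simp]: "qRe 1 = 1" "qI 1 = 0" "qJ 1 = 0" "qK 1 = 0"
  by (simp_all add: one_quat_def)

lemma quat_mult_sel [simp]:
  "qRe (x * y) = qRe x * qRe y - qI x * qI y - qJ x * qJ y - qK x * qK y"
  "qI (x * y) = qRe x * qI y + qI x * qRe y + qJ x * qK y - qK x * qJ y"
  "qJ (x * y) = qRe x * qJ y - qI x * qK y + qJ x * qRe y + qK x * qI y"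
  "qK (x * y) = qRe x * qK y + qI x * qJ y - qJ x * qI y + qK x * qRe y"
  by (simp_all add: times_quat_def)

instantiation quat :: real_algebra_1
begin

definition scaleR_quat where
  "r *\<^sub>R x = Quat (r * qRe x) (r * qI x) (r * qJ x) (r * qK x)"

instance
  by standard (simp_all add: scaleR_quat_def quat_eq_iff algebra_simps)

end

lemma quat_scaleR_sel [simp]:
  "qRe (r *\<^sub>R x) = r * qRe x" "qI (r *\<^sub>R x) = r * qI x"
  "qJ (r *\<^sub>R x) = r * qJ x" "qK (r *\<^sub>R x) = r * qK x"
  by (simp_all add: scaleR_quat_def)

definition qcnj :: "quat \<Rightarrow> quat" where
  "qcnj x = Quat (qRe x) (- qI x) (- qJ x) (- qK x)"

lemma qcnj_sel [simp]:
  "qRe (qcnj x) = qRe x" "qI (qcnj x) = - qI x" "qJ (qcnj x) = - qJ x" "qK (qcnj x) = - qK x"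
  by (simp_all add: qcnj_def)

instantiation quat :: real_inner
begin

definition inner_quat where
  "inner x y = qRe x * qRe y + qI x * qI y + qJ x * qJ y + qK x * qK y"
definition norm_quat where
  "norm x = sqrt ((qRe x)\<^sup>2 + (qI x)\<^sup>2 + (qJ x)\<^sup>2 + (qK x)\<^sup>2)"
definition sgn_quat where "sgn x = x /\<^sub>R norm (x :: quat)"
definition dist_quat where "dist x y = norm (x - y :: quat)"
definition uniformity_quat where
  "(uniformity :: (quat \<times> quat) filter) = (INF e\<in>{0<..}. principal {(x, y). dist x y < e})"
definition open_quat where
  "open (U :: quat set) \<longleftrightarrow> (\<forall>x\<in>U. eventually (\<lambda>(x', y). x' = x \<longrightarrow> y \<in> U) uniformity)"

instance
proof
  fix x y z :: quat and r :: real
  show "inner x x = 0 \<longleftrightarrow> x = 0"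
  proof
    assume "inner x x = 0"
    then have "(qRe x)\<^sup>2 + (qI x)\<^sup>2 + (qJ x)\<^sup>2 + (qK x)\<^sup>2 = 0"
      by (simp add: inner_quat_def power2_eq_square)
    then show "x = 0"
      by (simp add: quat_eq_iff add_nonneg_eq_0_iff)
  qed (simp add: inner_quat_def)
  show "inner (x + y) z = inner x z + inner y z" "inner (r *\<^sub>R x) y = r * inner x y"
    "inner x y = inner y x"
    by (simp_all add: inner_quat_def algebra_simps)
  show "0 \<le> inner x x" "norm x = sqrt (inner x x)"
    by (simp_all add: inner_quat_def norm_quat_def power2_eq_square)
qed (rule sgn_quat_def dist_quat_def uniformity_quat_def open_quat_def)+

end

instantiation quat :: division_ring
begin

definition inverse_quat where
  "inverse x = qcnj x /\<^sub>R (norm x)\<^sup>2"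
definition divide_quat where
  "x div (y :: quat) = x * inverse y"

instance
proof
  fix x y :: quat
  have sq: "(norm x)\<^sup>2 = qRe x * qRe x + qI x * qI x + qJ x * qJ x + qK x * qK x"
    by (simp add: norm_quat_def power2_eq_square)
  show "inverse x * x = 1" if "x \<noteq> 0"
  proof -
    have "qcnj x * x = (norm x)\<^sup>2 *\<^sub>R 1"
      by (simp add: quat_eq_iff sq algebra_simps)
    then show ?thesis using that by (simp add: inverse_quat_def)
  qed
  show "x * inverse x = 1" if "x \<noteq> 0"
  proof -
    have "x * qcnj x = (norm x)\<^sup>2 *\<^sub>R 1"
      by (simp add: quat_eq_iff sq algebra_simps)
    then show ?thesis using that by (simp add: inverse_quat_def)
  qed
qed (simp_all add: inverse_quat_def divide_quat_def)

end

instance quat :: real_normed_div_algebra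
proof
  fix x y :: quat
  have euler: "(a*e - b*f - c*g - d*h)\<^sup>2 + (a*f + b*e + c*h - d*g)\<^sup>2 +
      (a*g - b*h + c*e + d*f)\<^sup>2 + (a*h + b*g - c*f + d*e)\<^sup>2 =
      (a\<^sup>2 + b\<^sup>2 + c\<^sup>2 + d\<^sup>2) * (e\<^sup>2 + f\<^sup>2 + g\<^sup>2 + h\<^sup>2)" for a b c d e f g h :: real
    by algebra
  show "norm (x * y) = norm x * norm y"
    unfolding norm_quat_def quat_mult_sel euler by (rule real_sqrt_mult)
qed

text \<open>The Euclidean structure makes the quaternions a Banach space over the reals.\<close>

instantiation quat :: euclidean_space
begin

definition Basis_quat where
  "Basis = {Quat 1 0 0 0, Quat 0 1 0 0, Quat 0 0 1 0, Quat 0 0 0 1}"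

instance
proof
  fix x u v :: quat
  show "inner u v = (if u = v then 1 else 0)" if "u \<in> Basis" "v \<in> Basis"
    using that unfolding Basis_quat_def inner_quat_def by (elim insertE emptyE) simp_all
  show "(\<forall>u\<in>Basis. inner x u = 0) \<longleftrightarrow> x = 0"
    unfolding Basis_quat_def inner_quat_def quat_eq_iff[of x 0] by auto
qed (simp_all add: Basis_quat_def)

end

text \<open>The conjugacy class of \<open>q\<close>: the 2-sphere through \<open>q\<close> (a single point if \<open>q\<close> is real).\<close>

definition two_sphere :: "quat \<Rightarrow> quat set" where
  "two_sphere q = {p. \<exists>h. h \<noteq> 0 \<and> p = inverse h * q * h}"

definition imag_units :: "quat set" where
  "imag_units = {q. qRe q = 0 \<and> norm q = 1}"


section \<open>Quaternionic matrices\<close>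

definition hermitian :: "quat^'n^'n \<Rightarrow> bool" where
  "hermitian A \<longleftrightarrow> (\<forall>i j. A $ j $ i = qcnj (A $ i $ j))"

text \<open>In \<open>psd\<close>, the sum is \<open>c\<^sup>* A c\<close>; for a quaternion, being \<open>\<ge> 0\<close> includes being real.\<close>

definition psd :: "quat^'n^'n \<Rightarrow> bool" where
  "psd A \<longleftrightarrow> hermitian A \<and>
     (\<forall>c. let v = (\<Sum>i\<in>UNIV. qcnj (c $ i) * (A *v c) $ i) in v \<in> \<real> \<and> 0 \<le> qRe v)"


section \<open>Slice regular functions\<close>

definition slice_regular_on :: "(quat \<Rightarrow> quat) \<Rightarrow> quat set \<Rightarrow> bool" where
  "slice_regular_on f \<Omega> \<longleftrightarrow> open \<Omega> \<and> f differentiable_on \<Omega> \<and>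
     (\<forall>I\<in>imag_units. \<forall>x y. of_real x + I * of_real y \<in> \<Omega> \<longrightarrow>
        vector_derivative (\<lambda>t. f (of_real t + I * of_real y)) (at x)
        + I * vector_derivative (\<lambda>t. f (of_real x + I * of_real t)) (at y) = 0)"

abbreviation qball :: "quat set" where
  "qball \<equiv> ball 0 1"

text \<open>The slice regular self-maps of the unit ball into its closure. A function on the ball is
  represented by any total function extending it.\<close>

definition schur_class :: "(quat \<Rightarrow> quat) set" where
  "schur_class = {f. slice_regular_on f qball \<and> (\<forall>p\<in>qball. norm (f p) \<le> 1)}"

text \<open>The Taylor coefficients of a function that is slice regular on the unit ball; they are
  unique because the series converges to \<open>f\<close> on the real interval from -1 to 1.\<close>

definition qcoeffs :: "(quat \<Rightarrow> quat) \<Rightarrow> nat \<Rightarrow> quat" where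
  "qcoeffs f = (THE a. \<forall>p\<in>qball. (\<lambda>k. p ^ k * a k) sums f p)"

definition star :: "(quat \<Rightarrow> quat) \<Rightarrow> (quat \<Rightarrow> quat) \<Rightarrow> quat \<Rightarrow> quat" where
  "star g f p = (\<Sum>k. p ^ k * (\<Sum>r\<le>k. qcoeffs g r * qcoeffs f (k - r)))"

text \<open>The pointwise form of the star product, which does not need \<open>f\<close> to be defined on the whole
  ball.\<close>

definition star_pointwise :: "(quat \<Rightarrow> quat) \<Rightarrow> (quat \<Rightarrow> quat) \<Rightarrow> quat \<Rightarrow> quat" where
  "star_pointwise g f p = (if g p = 0 then 0 else g p * f (inverse (g p) * p * g p))"

definition regular_conj :: "(quat \<Rightarrow> quat) \<Rightarrow> quat \<Rightarrow> quat" where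
  "regular_conj f p = (\<Sum>k. p ^ k * qcnj (qcoeffs f k))"

definition star_inverse :: "(quat \<Rightarrow> quat) \<Rightarrow> quat \<Rightarrow> quat" where
  "star_inverse f p = inverse (star (regular_conj f) f p) * regular_conj f p"

definition star_inverse_dom :: "(quat \<Rightarrow> quat) \<Rightarrow> quat set" where
  "star_inverse_dom f = {p \<in> qball. star (regular_conj f) f p \<noteq> 0}"

text \<open>\<open>S\<close> is the star quotient of \<open>R\<close> by \<open>Q\<close> on the ball. The power series of
  \<open>star (regular_conj Q) Q\<close> has real coefficients, so \<open>star_inverse_dom Q\<close> contains with \<open>p\<close> every
  point of the ball conjugate to \<open>p\<close>; hence the right-hand side below evaluates the star inverse
  of \<open>Q\<close> only where it is defined. At the other points of the ball \<open>S\<close> is the limit of the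
  quotient; the condition \<open>p islimpt star_inverse_dom Q\<close> keeps that limit from being vacuous.\<close>

definition is_star_quotient :: "(quat \<Rightarrow> quat) \<Rightarrow> (quat \<Rightarrow> quat) \<Rightarrow> (quat \<Rightarrow> quat) \<Rightarrow> bool" where
  "is_star_quotient S R Q \<longleftrightarrow>
     (\<exists>p\<in>qball. Q p \<noteq> 0) \<and>
     (\<forall>p\<in>star_inverse_dom Q. S p = star_pointwise R (star_inverse Q) p) \<and>
     (\<forall>p\<in>qball - star_inverse_dom Q. p islimpt star_inverse_dom Q \<and>
        (star_pointwise R (star_inverse Q) \<longlongrightarrow> S p) (at p within star_inverse_dom Q))"


section \<open>The interpolation data\<close>

definition k_H2 :: "quat \<Rightarrow> quat \<Rightarrow> quat" where
  "k_H2 p q = (\<Sum>m. p ^ m * qcnj q ^ m)"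

definition pick_matrix :: "('n::finite \<Rightarrow> quat) \<Rightarrow> ('n \<Rightarrow> quat) \<Rightarrow> quat^'n^'n" where
  "pick_matrix p s = (\<chi> i j. \<Sum>k. p i ^ k * (1 - s i * qcnj (s j)) * qcnj (p j) ^ k)"

definition R_fun :: "('n::finite \<Rightarrow> quat) \<Rightarrow> quat^'n \<Rightarrow> quat \<Rightarrow> quat" where
  "R_fun p \<alpha> z = (\<Sum>i\<in>UNIV. k_H2 z (p i) * \<alpha> $ i)"

definition Q_fun :: "('n::finite \<Rightarrow> quat) \<Rightarrow> ('n \<Rightarrow> quat) \<Rightarrow> quat^'n \<Rightarrow> quat \<Rightarrow> quat" where
  "Q_fun p s \<alpha> z =
     (\<Sum>i | s i \<noteq> 0. k_H2 z (inverse (s i) * p i * s i) * qcnj (s i) * \<alpha> $ i)"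

definition interpolates :: "('n \<Rightarrow> quat) \<Rightarrow> ('n \<Rightarrow> quat) \<Rightarrow> (quat \<Rightarrow> quat) \<Rightarrow> bool" where
  "interpolates p s S \<longleftrightarrow> S \<in> schur_class \<and> (\<forall>i. S (p i) = s i)"

end

theory Submission
  imports Defs "HOL-Complex_Analysis.Complex_Analysis"
begin

text \<open>
  A function \<open>S\<close> in the Schur class has a power series (\<open>slice_regular_has_qseries\<close>), and star
  multiplication by \<open>S\<close> is a contraction on the space of square summable coefficient sequences
  (\<open>bounded_qseries_contraction\<close>). The scalar proof does not carry over directly, since evaluating \<open>S \<star> h\<close> on
  a slice involves \<open>S\<close> on other slices; but conjugation preserves norms and \<open>S\<close> is bounded by 1 on all
  slices at once. If \<open>S\<close> interpolates, the adjoint of this contraction maps the kernel function at \<open>p\<^sub>i\<close> to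
  the kernel function at \<open>p\<^sub>i\<close> preceded by \<open>cnj(s\<^sub>i)\<close>, and hence maps \<open>R\<close> to \<open>Q\<close>. The Pick form at \<open>y\<close> is
  the difference of the squared norms of \<open>R\<close> and \<open>Q\<close> (\<open>pick_matrix_quadratic_form\<close>).

  Let \<open>y\<close> be a nonzero kernel vector of the Pick matrix. Then the adjoint preserves the norm of \<open>R\<close>. A
  contraction that preserves the norm of a vector is undone on it by its adjoint
  (\<open>backward_shift_equality\<close>), so \<open>S \<star> Q = R\<close>. Moreover \<open>Q\<close> is not zero, for otherwise \<open>R\<close> would be zero,
  which a Vandermonde argument (\<open>quat_vandermonde\<close>) excludes: powers of distinct nodes are independent
  when no sphere contains three of them.

  Both claims follow from \<open>S \<star> Q = R\<close>. The star product has no zero divisors, so \<open>Q\<close> and \<open>R\<close> determine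
  \<open>S\<close>. Multiplying from the right by the conjugate of \<open>Q\<close> replaces \<open>Q\<close> by a series with real coefficients, by
  which one can divide pointwise away from its isolated zeros
  (\<open>is_star_quotient_of_factorization\<close>).
\<close>


section \<open>Quaternion arithmetic\<close>

lemma quat_of_real_sel [simp]: "qRe (of_real r) = r" "qI (of_real r) = 0" "qJ (of_real r) = 0" "qK (of_real r) = 0"
  by (simp_all add: of_real_def)

lemma quat_numeral_sel [simp]: "qRe (numeral n) = numeral n" "qI (numeral n) = 0" "qJ (numeral n) = 0" "qK (numeral n) = 0"
  using quat_of_real_sel[of "numeral n"] by simp_all

lemma qcnj_simps [simp]: "qcnj 0 = 0" "qcnj 1 = 1" "qcnj (qcnj x) = x" "qcnj (x + y) = qcnj x + qcnj y"
  "qcnj (x * y) = qcnj y * qcnj x" "qcnj (x - y) = qcnj x - qcnj y" "qcnj (- x) = - qcnj x"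
  by (simp_all add: quat_eq_iff algebra_simps)

lemma qcnj_eq_0_iff [simp]: "qcnj x = 0 \<longleftrightarrow> x = 0"
  by (auto simp: quat_eq_iff)

lemma qcnj_sum: "qcnj (\<Sum>i\<in>A. f i) = (\<Sum>i\<in>A. qcnj (f i))"
  by (induction A rule: infinite_finite_induct) simp_all

lemma qcnj_power [simp]: "qcnj (x ^ k) = qcnj x ^ k"
  by (induction k) (simp_all add: power_commutes)

lemma norm_qcnj [simp]: "norm (qcnj x) = norm x"
  by (simp add: norm_quat_def)

lemma mult_qcnj: "x * qcnj x = of_real ((norm x)\<^sup>2)" "qcnj x * x = of_real ((norm x)\<^sup>2)"
  by (simp_all add: quat_eq_iff norm_quat_def power2_eq_square)

lemma inner_mult_left_quat: "inner (x * y) (z::quat) = inner y (qcnj x * z)"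
  by (simp add: inner_quat_def algebra_simps)

lemma inner_mult_right_quat: "inner (x * y) (z::quat) = inner x (z * qcnj y)"
  by (simp add: inner_quat_def algebra_simps)

lemma quat_of_real_commute: "of_real r * (x::quat) = x * of_real r"
  by (simp add: quat_eq_iff)

lemma bounded_linear_qRe: "bounded_linear qRe"
  using bounded_linear_inner_left[of "1 :: quat"] by (simp add: inner_quat_def)

lemma norm_power2_quat: "(norm (x::quat))\<^sup>2 = (qRe x)\<^sup>2 + (qI x)\<^sup>2 + (qJ x)\<^sup>2 + (qK x)\<^sup>2"
  by (simp add: norm_quat_def)


section \<open>Conjugacy classes and independence of powers\<close>

text \<open>The sum of the imaginary parts intertwines \<open>p\<close> and \<open>q\<close>. It vanishes only if \<open>p\<close> is the conjugate
  of \<open>q\<close>; then any nonzero purely imaginary quaternion orthogonal to the imaginary part will do.\<close>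

lemma same_real_part_norm_imp_conjugate:
  assumes re: "qRe p = qRe q" and no: "norm p = norm q"
  shows "p \<in> two_sphere q"
proof -
  have no2: "(qI p)\<^sup>2 + (qJ p)\<^sup>2 + (qK p)\<^sup>2 = (qI q)\<^sup>2 + (qJ q)\<^sup>2 + (qK q)\<^sup>2"
    using arg_cong[OF no, of "\<lambda>t. t\<^sup>2"] re by (simp add: norm_power2_quat)
  have "\<exists>h. h \<noteq> 0 \<and> h * p = q * h"
  proof (cases "p = qcnj q")
    case False
    let ?h = "p - of_real (qRe p) + (q - of_real (qRe q))"
    have "?h \<noteq> 0"
      using False re by (auto simp: quat_eq_iff)
    moreover have "?h * p = q * ?h"
      using re no2 by (simp add: quat_eq_iff algebra_simps power2_eq_square)
    ultimately show ?thesis by blast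
  next
    case True
    show ?thesis
    proof (cases "qJ q = 0 \<and> qK q = 0")
      case True
      with \<open>p = qcnj q\<close> show ?thesis
        by (intro exI[of _ "Quat 0 0 1 0"]) (simp add: quat_eq_iff)
    next
      case False
      with \<open>p = qcnj q\<close> show ?thesis
        by (intro exI[of _ "Quat 0 0 (- qK q) (qJ q)"]) (auto simp add: quat_eq_iff algebra_simps)
    qed
  qed
  then obtain h where "h \<noteq> 0" "h * p = q * h" by blast
  then have "p = inverse h * q * h"
    by (metis mult.assoc left_inverse mult_1)
  with \<open>h \<noteq> 0\<close> show ?thesis by (auto simp: two_sphere_def)
qed

lemma minimal_polynomial_zero_iff:
  "p ^ 2 - of_real (2 * qRe q) * p + of_real ((norm q)\<^sup>2) = 0 \<longleftrightarrow> qRe p = qRe q \<and> norm p = norm (q::quat)"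
  (is "?L = 0 \<longleftrightarrow> _")
proof
  have *: "norm p = norm q \<longleftrightarrow> (norm p)\<^sup>2 = (norm q)\<^sup>2" by simp
  show "?L = 0" if "qRe p = qRe q \<and> norm p = norm q"
    using that norm_power2_quat[of p] by (simp add: quat_eq_iff power2_eq_square algebra_simps)
  assume "?L = 0"
  then have e: "qRe p * qRe p - qI p * qI p - qJ p * qJ p - qK p * qK p - 2 * qRe q * qRe p + (norm q)\<^sup>2 = 0"
    "(qRe p - qRe q) * qI p = 0" "(qRe p - qRe q) * qJ p = 0" "(qRe p - qRe q) * qK p = 0"
    by (simp_all add: quat_eq_iff power2_eq_square algebra_simps)
  have "qRe p = qRe q"
  proof (rule ccontr)
    assume ne: "qRe p \<noteq> qRe q"
    then have "qI p = 0" "qJ p = 0" "qK p = 0" using e by auto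
    with e(1) have "(qRe p - qRe q)\<^sup>2 + (qI q)\<^sup>2 + (qJ q)\<^sup>2 + (qK q)\<^sup>2 = 0"
      using norm_power2_quat[of q] by (simp add: power2_eq_square algebra_simps)
    with ne show False
      by (smt (verit) power2_less_0 power2_eq_square mult_eq_0_iff)
  qed
  moreover have "(norm p)\<^sup>2 = (norm q)\<^sup>2"
    using e(1) \<open>qRe p = qRe q\<close> norm_power2_quat[of p] by (simp add: power2_eq_square algebra_simps)
  ultimately show "qRe p = qRe q \<and> norm p = norm q" unfolding * by blast
qed

text \<open>Multiplying each coefficient by the value at its node of the real polynomial that vanishes exactly
  on the sphere of \<open>p a\<close> removes the nodes on that sphere and preserves the relations, because real
  coefficients commute. By induction the coefficients off the sphere vanish. At most two nodes remain,
  and the relations for \<open>k = 0\<close> and \<open>k = 1\<close> settle them.\<close>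

lemma quat_vandermonde:
  fixes p x :: "'n \<Rightarrow> quat"
  assumes "finite A" "inj_on p A"
    and "\<And>i j k. i \<in> A \<Longrightarrow> j \<in> A \<Longrightarrow> k \<in> A \<Longrightarrow> i \<noteq> j \<Longrightarrow> j \<noteq> k \<Longrightarrow> i \<noteq> k \<Longrightarrow>
      \<not> {p i, p j, p k} \<subseteq> two_sphere (p i)"
    and "\<And>k. (\<Sum>i\<in>A. x i * p i ^ k) = 0" and "a \<in> A"
  shows "x a = 0"
  using assms
proof (induction "card A" arbitrary: A x a rule: less_induct)
  case less
  note fin = less.prems(1) and inj = less.prems(2) and three = less.prems(3)
    and van = less.prems(4) and aA = less.prems(5)
  define \<mu> where "\<mu> t = t ^ 2 - of_real (2 * qRe (p a)) * t + of_real ((norm (p a))\<^sup>2)" for t :: quat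
  define C where "C = {i \<in> A. \<mu> (p i) = 0}"
  have aC: "a \<in> C"
    unfolding C_def \<mu>_def using aA by (simp only: minimal_polynomial_zero_iff) simp
  have "x i = 0" if i: "i \<in> A - C" for i
  proof -
    have "x i * \<mu> (p i) = 0"
    proof (rule less.hyps[where A = "A - C" and x = "\<lambda>i. x i * \<mu> (p i)"])
      show "card (A - C) < card A"
        by (rule psubset_card_mono[OF fin]) (use aC aA in auto)
      fix k
      have "x i * \<mu> (p i) * p i ^ k = x i * p i ^ (k + 2)
          - of_real (2 * qRe (p a)) * (x i * p i ^ (k + 1)) + of_real ((norm (p a))\<^sup>2) * (x i * p i ^ k)" for i
      proof -
        have "\<mu> t * t ^ k = t ^ (k + 2) - of_real (2 * qRe (p a)) * t ^ (k + 1)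
            + of_real ((norm (p a))\<^sup>2) * t ^ k" for t
          unfolding \<mu>_def power_add power_one_right left_diff_distrib distrib_right mult.assoc
          by (simp only: power_commutes mult.assoc[symmetric] power2_eq_square)
            (simp only: power_commutes mult.assoc)
        then have "x i * \<mu> (p i) * p i ^ k = x i * (p i ^ (k + 2) - of_real (2 * qRe (p a)) * p i ^ (k + 1)
            + of_real ((norm (p a))\<^sup>2) * p i ^ k)"
          by (simp only: mult.assoc)
        moreover have "x i * (of_real r * u) = of_real r * (x i * u)" for r u
          using quat_of_real_commute[of r "x i"] by (simp only: mult.assoc[symmetric])
        ultimately show ?thesis
          by (simp only: distrib_left right_diff_distrib)
      qed
      then have "(\<Sum>i\<in>A. x i * \<mu> (p i) * p i ^ k) = (\<Sum>i\<in>A. x i * p i ^ (k + 2))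
          - of_real (2 * qRe (p a)) * (\<Sum>i\<in>A. x i * p i ^ (k + 1))
          + of_real ((norm (p a))\<^sup>2) * (\<Sum>i\<in>A. x i * p i ^ k)"
        by (simp only: sum_subtractf sum.distrib sum_distrib_left)
      also have "\<dots> = 0" by (simp only: van) simp
      finally have "(\<Sum>i\<in>A. x i * \<mu> (p i) * p i ^ k) = 0" .
      moreover have "(\<Sum>i\<in>A - C. x i * \<mu> (p i) * p i ^ k) = (\<Sum>i\<in>A. x i * \<mu> (p i) * p i ^ k)"
        by (rule sum.mono_neutral_left[OF fin]) (auto simp: C_def)
      ultimately show "(\<Sum>i\<in>A - C. x i * \<mu> (p i) * p i ^ k) = 0" by simp
    qed (use fin i three inj in \<open>auto intro: inj_on_subset\<close>)
    with i show ?thesis by (auto simp: C_def)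
  qed
  then have vanC: "(\<Sum>i\<in>C. x i * p i ^ k) = 0" for k
  proof -
    have "(\<Sum>i\<in>C. x i * p i ^ k) = (\<Sum>i\<in>A. x i * p i ^ k)"
      by (rule sum.mono_neutral_left[OF fin]) (use \<open>\<And>i. i \<in> A - C \<Longrightarrow> x i = 0\<close> in \<open>auto simp: C_def\<close>)
    with van show ?thesis by simp
  qed
  \<comment> \<open>The nodes in \<open>C\<close> are conjugate to \<open>p a\<close>, so no three of them are distinct.\<close>
  have sph: "p i \<in> two_sphere (p a)" if "i \<in> C" for i
    using that unfolding C_def \<mu>_def minimal_polynomial_zero_iff
    by (auto intro: same_real_part_norm_imp_conjugate)
  show "x a = 0"
  proof (cases "C = {a}")
    case True
    with vanC[of 0] show ?thesis by simp
  next
    case False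
    then obtain b where b: "b \<in> C" "b \<noteq> a" using aC by blast
    have "i = a \<or> i = b" if "i \<in> C" for i
      using three[of a b i] b aC that sph by (auto simp: C_def)
    then have C: "C = {a, b}" using aC b by auto
    have e: "x a + x b = 0" "x a * p a + x b * p b = 0"
      using vanC[of 0] vanC[of 1] b unfolding C by auto
    then have "x b = - x a" by (simp add: add_eq_0_iff)
    with e(2) have "x a * (p a - p b) = 0" by (simp add: algebra_simps)
    moreover have "p a \<noteq> p b" using inj b aC by (auto simp: C_def inj_on_def)
    ultimately show ?thesis by simp
  qed
qed


section \<open>Power series and the star product\<close>

text \<open>Coefficient sequences are kept as \<^typ>\<open>quat fps\<close>, because multiplication of formal power
  series over the noncommutative ring of quaternions is exactly the star product. The type class
  instances then supply associativity and the absence of zero divisors.\<close>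

definition has_qseries :: "(quat \<Rightarrow> quat) \<Rightarrow> quat fps \<Rightarrow> bool" where
  "has_qseries f F \<longleftrightarrow> (\<forall>p\<in>qball. (\<lambda>k. p ^ k * fps_nth F k) sums f p)"

lemma has_qseriesD: "has_qseries f F \<Longrightarrow> norm p < 1 \<Longrightarrow> (\<lambda>k. p ^ k * fps_nth F k) sums f p"
  by (simp add: has_qseries_def)

lemma quat_of_real_power_commute: "of_real r ^ k * (x :: quat) = x * of_real r ^ k"
  by (metis of_real_power quat_of_real_commute)

lemma real_summable_imp_norm_summable:
  fixes a :: "nat \<Rightarrow> quat"
  assumes "\<And>x. 0 \<le> x \<Longrightarrow> x < 1 \<Longrightarrow> summable (\<lambda>k. of_real x ^ k * a k)" "0 \<le> r" "r < 1"
  shows "summable (\<lambda>k. r ^ k * norm (a k))"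
proof -
  have "summable (\<lambda>k. a k * of_real ((1 + r) / 2) ^ k)"
    using assms(1)[of "(1 + r) / 2"] assms(2,3) by (simp only: quat_of_real_power_commute) simp
  moreover have "norm (of_real r :: quat) < norm (of_real ((1 + r) / 2) :: quat)"
    using assms by (simp only: norm_of_real) simp
  ultimately have "summable (\<lambda>k. norm (a k * of_real r ^ k))"
    by (rule powser_insidea)
  then show ?thesis using assms by (simp add: norm_mult norm_power mult.commute)
qed

lemma qseries_norm_summable:
  assumes "has_qseries f F" "0 \<le> r" "r < 1"
  shows "summable (\<lambda>k. r ^ k * norm (fps_nth F k))"
  using assms
  by (intro real_summable_imp_norm_summable) (auto intro!: sums_summable[OF has_qseriesD])

text \<open>The real segment already determines the coefficients: paired with a fixed quaternion \<open>w\<close>, the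
  difference of the two series becomes an ordinary real power series that vanishes on it.\<close>

lemma qseries_unique:
  assumes F: "has_qseries f F" and G: "has_qseries f G"
  shows "F = G"
proof -
  have "inner (fps_nth F m - fps_nth G m) w = 0" for m w
  proof (rule ccontr)
    let ?a = "\<lambda>k. inner (fps_nth F k - fps_nth G k) w"
    assume m: "?a m \<noteq> 0"
    have sums: "(\<lambda>k. ?a k * x ^ k) sums 0" if "norm x < 1" for x :: real
    proof -
      have "(\<lambda>k. of_real x ^ k * fps_nth F k - of_real x ^ k * fps_nth G k) sums (f (of_real x) - f (of_real x))"
        by (intro sums_diff has_qseriesD F G) (use that in auto)
      then have "(\<lambda>k. inner (x ^ k *\<^sub>R (fps_nth F k - fps_nth G k)) w) sums inner 0 w"
        by (intro bounded_linear.sums[OF bounded_linear_inner_left])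
          (simp add: scaleR_conv_of_real algebra_simps)
      then show ?thesis by (simp add: mult.commute)
    qed
    have "?a 0 = 0" using sums[of 0] by (simp add: powser_sums_zero_iff)
    with m have "m > 0" by (metis gr0I)
    obtain s where "0 < s" "\<And>z. z \<in> cball (0::real) s - {0} \<Longrightarrow> (0::real) \<noteq> 0"
      by (rule powser_0_nonzero[where r = 1 and \<xi> = 0 and a = ?a and f = "\<lambda>_. 0", OF _ _ _ m \<open>m > 0\<close>])
        (use sums in auto)
    then show False by (metis Diff_iff mem_cball_0 real_norm_def abs_of_pos less_eq_real_def singletonD less_irrefl)
  qed
  then have "fps_nth F m - fps_nth G m = 0" for m
    by (metis inner_eq_zero_iff)
  then show ?thesis by (simp add: fps_eq_iff)
qed

lemma qcoeffs_eq:
  assumes "has_qseries f F"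
  shows "qcoeffs f = fps_nth F"
  unfolding qcoeffs_def
proof (rule the_equality)
  show "\<forall>p\<in>qball. (\<lambda>k. p ^ k * fps_nth F k) sums f p"
    using assms by (simp add: has_qseries_def)
  fix a assume "\<forall>p\<in>qball. (\<lambda>k. p ^ k * a k) sums f p"
  then have "has_qseries f (Abs_fps a)" by (simp add: has_qseries_def)
  then have "Abs_fps a = F" by (rule qseries_unique[OF _ assms])
  then show "a = fps_nth F" by auto
qed

text \<open>The Cauchy product behind the pointwise form of the star product. In
  \<open>p ^ (m + r) * G\<^sub>r * F\<^sub>m = p ^ m * (p ^ r * G\<^sub>r) * F\<^sub>m\<close> the coefficient of \<open>G\<close> sits between the power of \<open>p\<close> and the
  coefficient of \<open>F\<close>, so this is no product of two terms. Instead, the absolutely convergent double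
  series is summed along rows and along antidiagonals.\<close>

lemma qseries_mult_sums:
  assumes g: "has_qseries g G" and f: "has_qseries f F" and p: "norm p < 1"
  shows "(\<lambda>k. p ^ k * fps_nth (G * F) k) sums (\<Sum>m. p ^ m * g p * fps_nth F m)"
    and "summable (\<lambda>m. p ^ m * g p * fps_nth F m)"
proof -
  define h where "h = (\<lambda>(m, r). p ^ m * (p ^ r * fps_nth G r) * fps_nth F m)"
  have sF: "summable (\<lambda>k. norm p ^ k * norm (fps_nth F k))"
    and sG: "summable (\<lambda>k. norm p ^ k * norm (fps_nth G k))"
    using qseries_norm_summable[OF f] qseries_norm_summable[OF g] p by auto
  have hG: "((\<lambda>r. p ^ r * fps_nth G r) has_sum g p) UNIV"
    by (rule norm_summable_imp_has_sum[OF _ has_qseriesD[OF g p]])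
      (use sG in \<open>simp add: norm_mult norm_power\<close>)
  have hGn: "((\<lambda>r. norm (p ^ r * fps_nth G r)) has_sum (\<Sum>r. norm p ^ r * norm (fps_nth G r))) UNIV"
    (is "(_ has_sum ?s) _")
    by (rule sums_nonneg_imp_has_sum) (use sG in \<open>auto simp add: norm_mult norm_power summable_sums\<close>)
  have in_h: "((\<lambda>r. h (m, r)) has_sum p ^ m * g p * fps_nth F m) UNIV" for m
    unfolding h_def prod.case
    by (rule has_sum_cmult_left has_sum_cmult_right hG)+
  have in_hn: "((\<lambda>r. norm (h (m, r))) has_sum norm p ^ m * ?s * norm (fps_nth F m)) UNIV" for m
    unfolding h_def prod.case norm_mult norm_power
    by (rule has_sum_cmult_left has_sum_cmult_right hGn[unfolded norm_mult norm_power])+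
  have "(\<lambda>x. norm (h x)) summable_on UNIV \<times> UNIV"
    unfolding Infinite_Sum.abs_summable_on_Sigma_iff
  proof (intro conjI ballI)
    show "(\<lambda>r. norm (h (m, r))) summable_on UNIV" for m
      using in_hn has_sum_imp_summable by blast
    have "summable (\<lambda>m. norm p ^ m * norm (fps_nth F m) * ?s)"
      by (rule summable_mult2[OF sF])
    moreover have "0 \<le> ?s" by (rule suminf_nonneg[OF sG]) auto
    ultimately show "(\<lambda>m. norm (infsum (\<lambda>r. norm (h (m, r))) UNIV)) summable_on UNIV"
      unfolding infsumI[OF in_hn]
      by (intro norm_summable_imp_summable_on) (simp add: mult_ac norm_mult)
  qed
  then have "h summable_on UNIV \<times> UNIV" by (rule abs_summable_summable)
  then obtain H where H: "(h has_sum H) (UNIV \<times> UNIV)" by (auto simp: summable_on_def)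
  have 1: "(\<lambda>m. p ^ m * g p * fps_nth F m) sums H"
    by (rule has_sum_imp_sums[OF has_sum_SigmaD[OF H]]) (use in_h in auto)
  have "((\<lambda>(k, r). h (k - r, r)) has_sum H) (SIGMA k:UNIV. {..k}) = (h has_sum H) (UNIV \<times> UNIV)"
    by (rule has_sum_reindex_bij_witness[where j = "\<lambda>(k, r). (k - r, r)" and i = "\<lambda>(m, r). (m + r, r)"]) auto
  with H have H': "((\<lambda>(k, r). h (k - r, r)) has_sum H) (SIGMA k:UNIV. {..k})" by simp
  have "(\<lambda>k. \<Sum>r\<le>k. h (k - r, r)) sums H"
    by (rule has_sum_imp_sums[OF has_sum_SigmaD[OF H']]) (auto intro: has_sum_finiteI)
  moreover have "(\<Sum>r\<le>k. h (k - r, r)) = p ^ k * fps_nth (G * F) k" for k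
    unfolding fps_mult_nth sum_distrib_left atLeast0AtMost h_def prod.case
    by (rule sum.cong) (auto simp: mult.assoc[symmetric] power_add[symmetric])
  ultimately show "(\<lambda>k. p ^ k * fps_nth (G * F) k) sums (\<Sum>m. p ^ m * g p * fps_nth F m)"
    using sums_unique[OF 1] by simp
  show "summable (\<lambda>m. p ^ m * g p * fps_nth F m)"
    using 1 by (rule sums_summable)
qed

lemma has_qseries_star:
  assumes g: "has_qseries g G" and f: "has_qseries f F"
  shows "has_qseries (star g f) (G * F)"
proof -
  have "star g f p = (\<Sum>k. p ^ k * fps_nth (G * F) k)" for p
    by (simp add: star_def qcoeffs_eq[OF g] qcoeffs_eq[OF f] fps_mult_nth atLeast0AtMost)
  then show ?thesis
    unfolding has_qseries_def using sums_summable[OF qseries_mult_sums(1)[OF g f]]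
    by (simp add: summable_sums)
qed

lemma star_eq_suminf:
  assumes g: "has_qseries g G" and f: "has_qseries f F" and p: "norm p < 1"
  shows "star g f p = (\<Sum>m. p ^ m * g p * fps_nth F m)"
  using sums_unique2[OF qseries_mult_sums(1)[OF assms] has_qseriesD[OF has_qseries_star[OF g f] p]]
  by simp

text \<open>This identity turns \<open>g * f(g\<^sup>-\<^sup>1 p g)\<close> into a power series in \<open>p\<close> itself.\<close>

lemma conjugate_power:
  "(g::quat) \<noteq> 0 \<Longrightarrow> g * (inverse g * p * g) ^ m = p ^ m * g"
proof (induction m)
  case (Suc m)
  have "g * (inverse g * p * g) ^ Suc m = (g * inverse g) * p * (g * (inverse g * p * g) ^ m)"
    by (simp add: mult.assoc)
  with Suc show ?case by (simp add: mult.assoc)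
qed simp

lemma norm_conjugate: "(g::quat) \<noteq> 0 \<Longrightarrow> norm (inverse g * p * g) = norm p"
  by (simp add: norm_mult norm_inverse)

lemma star_eq_star_pointwise:
  assumes g: "has_qseries g G" and f: "has_qseries f F" and p: "norm p < 1"
  shows "star g f p = star_pointwise g f p"
proof (cases "g p = 0")
  case False
  have "(\<lambda>m. g p * ((inverse (g p) * p * g p) ^ m * fps_nth F m)) sums (g p * f (inverse (g p) * p * g p))"
    by (intro sums_mult has_qseriesD[OF f]) (use False p in \<open>simp add: norm_conjugate\<close>)
  then have "(\<lambda>m. p ^ m * g p * fps_nth F m) sums (g p * f (inverse (g p) * p * g p))"
    by (simp only: mult.assoc[symmetric] conjugate_power[OF False])
  with False show ?thesis
    unfolding star_eq_suminf[OF assms] star_pointwise_def by (simp add: sums_iff)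
qed (simp add: star_eq_suminf[OF assms] star_pointwise_def)

text \<open>Real coefficients commute with everything, so multiplying by such a series is pointwise
  multiplication.\<close>

lemma star_real_coeffs:
  assumes g: "has_qseries g G" and f: "has_qseries f F" and p: "norm p < 1"
    and r: "\<And>k. fps_nth F k \<in> \<real>"
  shows "star g f p = f p * g p"
proof -
  have "p ^ m * g p * fps_nth F m = p ^ m * fps_nth F m * g p" for m
    using r[of m] by (auto elim!: Reals_cases simp: mult.assoc quat_of_real_commute)
  moreover have "(\<lambda>m. p ^ m * fps_nth F m * g p) sums (f p * g p)"
    by (intro sums_mult2 has_qseriesD[OF f] p)
  ultimately show ?thesis
    unfolding star_eq_suminf[OF g f p] by (simp add: sums_iff)
qed

definition fps_qcnj :: "quat fps \<Rightarrow> quat fps" where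
  "fps_qcnj F = Abs_fps (\<lambda>k. qcnj (fps_nth F k))"

lemma has_qseries_regular_conj:
  assumes f: "has_qseries f F"
  shows "has_qseries (regular_conj f) (fps_qcnj F)"
  unfolding has_qseries_def
proof
  fix p assume "p \<in> qball"
  then have "summable (\<lambda>k. norm (p ^ k * qcnj (fps_nth F k)))"
    using qseries_norm_summable[OF f, of "norm p"] by (simp add: norm_mult norm_power)
  then show "(\<lambda>k. p ^ k * fps_nth (fps_qcnj F) k) sums regular_conj f p"
    unfolding regular_conj_def qcoeffs_eq[OF f] fps_qcnj_def
    using summable_norm_cancel summable_sums by fastforce
qed

text \<open>The symmetrization of a series. Conjugation reverses products, so both products equal their own
  conjugate and are real; they agree because \<open>x y\<close> and \<open>y x\<close> have the same real part.\<close>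

lemma fps_qcnj_times_self:
  "F * fps_qcnj F = fps_qcnj F * F" "fps_nth (fps_qcnj F * F) k \<in> \<real>"
proof -
  let ?c = "fps_qcnj F"
  have nth: "fps_nth (?c * F) k = (\<Sum>i=0..k. qcnj (fps_nth F i) * fps_nth F (k - i))"
    "fps_nth (F * ?c) k = (\<Sum>i=0..k. fps_nth F i * qcnj (fps_nth F (k - i)))" for k
    by (simp_all add: fps_mult_nth fps_qcnj_def)
  have rev: "(\<Sum>i=0..k. h i (k - i)) = (\<Sum>i=0..k. h (k - i) i)" for h :: "nat \<Rightarrow> nat \<Rightarrow> 'a::comm_monoid_add" and k
    by (rule sum.reindex_bij_witness[where i = "\<lambda>i. k - i" and j = "\<lambda>i. k - i"]) auto
  have real: "x = qcnj x \<Longrightarrow> x = of_real (qRe x)" for x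
    by (auto simp: quat_eq_iff)
  have cnj: "qcnj (fps_nth (?c * F) k) = fps_nth (?c * F) k" "qcnj (fps_nth (F * ?c) k) = fps_nth (F * ?c) k" for k
    unfolding nth qcnj_sum
    using rev[of "\<lambda>i j. qcnj (fps_nth F i) * fps_nth F j" k] rev[of "\<lambda>i j. fps_nth F i * qcnj (fps_nth F j)" k]
    by simp_all
  show "fps_nth (?c * F) k \<in> \<real>"
    using real[OF cnj(1)[symmetric]] by (metis Reals_of_real)
  have "qRe (\<Sum>i=0..k. f i) = (\<Sum>i=0..k. qRe (f i))" for f k
    by (rule bounded_linear.linear[THEN linear_sum, OF bounded_linear_qRe])
  moreover have "qRe (x * y) = qRe (y * x)" for x y by simp
  ultimately have "qRe (fps_nth (F * ?c) k) = qRe (fps_nth (?c * F) k)" for k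
    unfolding nth using rev[of "\<lambda>i j. qRe (fps_nth F i * qcnj (fps_nth F j))" k] by (metis (no_types, lifting) sum.cong)
  then have "fps_nth (F * ?c) k = fps_nth (?c * F) k" for k
    using real[OF cnj(1)[symmetric]] real[OF cnj(2)[symmetric]] by metis
  then show "F * ?c = ?c * F" by (simp add: fps_eq_iff)
qed


section \<open>Taylor expansion of slice regular functions\<close>

text \<open>The slice \<open>C\<^sub>I\<close>, parametrized by the complex plane.\<close>

definition slice_emb :: "quat \<Rightarrow> complex \<Rightarrow> quat" where
  "slice_emb I z = of_real (Re z) + I * of_real (Im z)"

text \<open>The real linear functional that becomes complex linear when \<open>I\<close> acts on quaternions from the left.
  It reduces quaternion-valued functions on the slice of \<open>I\<close> to scalar holomorphic functions.\<close>

definition slice_fun :: "quat \<Rightarrow> quat \<Rightarrow> complex" where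
  "slice_fun I w = Complex (qRe w) (- qRe (I * w))"

lemma imag_unit_square: "I \<in> imag_units \<Longrightarrow> I * I = -1"
  using mult_qcnj(1)[of I] by (simp add: imag_units_def quat_eq_iff)

lemma slice_emb_add: "slice_emb I (y + z) = slice_emb I y + slice_emb I z"
  by (simp add: slice_emb_def algebra_simps)

lemma slice_emb_scaleR: "slice_emb I z = Re z *\<^sub>R 1 + Im z *\<^sub>R I"
  by (simp add: slice_emb_def of_real_def)

lemma slice_emb_of_real [simp]: "slice_emb I (of_real r) = of_real r"
  by (simp add: slice_emb_def)

lemma slice_emb_mult:
  assumes "I \<in> imag_units"
  shows "slice_emb I (y * z) = slice_emb I y * slice_emb I z"
  by (simp add: slice_emb_scaleR algebra_simps imag_unit_square[OF assms])

lemma slice_emb_power: "I \<in> imag_units \<Longrightarrow> slice_emb I (z ^ k) = slice_emb I z ^ k"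
  by (induction k) (simp_all add: slice_emb_mult slice_emb_of_real[of I 1, simplified])

lemma norm_slice_emb: "I \<in> imag_units \<Longrightarrow> norm (slice_emb I z) = norm z"
proof -
  assume I: "I \<in> imag_units"
  then have "(qI I)\<^sup>2 + (qJ I)\<^sup>2 + (qK I)\<^sup>2 = 1" "qRe I = 0"
    using norm_power2_quat[of I] by (simp_all add: imag_units_def)
  moreover have "(qI I * y)\<^sup>2 + (qJ I * y)\<^sup>2 + (qK I * y)\<^sup>2 = ((qI I)\<^sup>2 + (qJ I)\<^sup>2 + (qK I)\<^sup>2) * y\<^sup>2" for y
    by (simp add: algebra_simps power_mult_distrib)
  ultimately show "norm (slice_emb I z) = norm z" by (simp add: norm_quat_def slice_emb_def cmod_def add.assoc)
qed

lemma bounded_linear_slice_emb: "I \<in> imag_units \<Longrightarrow> bounded_linear (slice_emb I)"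
  by (rule bounded_linear_intro[where K = 1], rule slice_emb_add)
    (simp add: slice_emb_scaleR algebra_simps, simp add: norm_slice_emb)

lemma bounded_linear_slice_fun: "bounded_linear (slice_fun I)"
proof -
  have "bounded_linear (\<lambda>w. qRe w - \<i> * qRe (I * w))"
    by (intro bounded_linear_sub bounded_linear_mult_const bounded_linear_const_mult
      bounded_linear_compose[OF bounded_linear_of_real] bounded_linear_qRe
      bounded_linear_compose[OF bounded_linear_qRe] bounded_linear_mult_right)
  moreover have "(\<lambda>w. qRe w - \<i> * qRe (I * w)) = slice_fun I"
    by (simp add: fun_eq_iff slice_fun_def complex_eq_iff)
  ultimately show ?thesis by metis
qed

lemma slice_fun_mult:
  assumes "I \<in> imag_units"
  shows "slice_fun I (slice_emb I z * w) = z * slice_fun I w"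
proof -
  have "I * (slice_emb I z * w) = Re z *\<^sub>R (I * w) - Im z *\<^sub>R w"
    by (simp add: slice_emb_scaleR algebra_simps imag_unit_square[OF assms] flip: mult.assoc)
  moreover have "slice_emb I z * w = Re z *\<^sub>R w + Im z *\<^sub>R (I * w)"
    by (simp add: slice_emb_scaleR algebra_simps)
  ultimately show ?thesis
    unfolding slice_fun_def by (simp only:) (simp add: complex_eq_iff algebra_simps)
qed

lemma obtain_slice:
  obtains I z where "I \<in> imag_units" "p = slice_emb I z" "norm z = norm p"
proof -
  have "\<exists>I z. I \<in> imag_units \<and> p = slice_emb I z"
  proof (cases "p = of_real (qRe p)")
    case True
    then show ?thesis
      by (intro exI[of _ "Quat 0 1 0 0"] exI[of _ "of_real (qRe p)"]) (simp add: imag_units_def norm_quat_def)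
  next
    case False
    define v where "v = p - of_real (qRe p)"
    have v: "v \<noteq> 0" "qRe v = 0" using False by (auto simp: v_def)
    show ?thesis
      by (intro exI[of _ "v /\<^sub>R norm v"] exI[of _ "Complex (qRe p) (norm v)"])
        (use v in \<open>simp add: imag_units_def slice_emb_def quat_eq_iff, simp add: v_def\<close>)
  qed
  then show ?thesis using that norm_slice_emb by metis
qed

text \<open>The slice equation says that the differential of \<open>f\<close> commutes with left multiplication by \<open>I\<close>
  along the slice: it sends \<open>h\<close> to \<open>h * f'(1)\<close>. Under a complex linear functional this is complex
  differentiability. Multiplication by \<open>v\<close> on the right is harmless, and enough values of \<open>v\<close> recover
  \<open>f\<close>.\<close>

lemma slice_regular_holomorphic:
  assumes f: "slice_regular_on f qball" and I: "I \<in> imag_units"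
  shows "(\<lambda>z. slice_fun I (f (slice_emb I z) * v)) holomorphic_on ball 0 1"
proof (rule holomorphic_onI)
  fix z :: complex assume z: "z \<in> ball 0 1"
  let ?p = "slice_emb I z"
  have pb: "?p \<in> qball" using z by (simp add: norm_slice_emb[OF I])
  with f have "f differentiable at ?p"
    by (auto simp: slice_regular_on_def differentiable_on_def at_within_open[OF _ open_ball])
  then obtain f' where f': "(f has_derivative f') (at ?p)" by (auto simp: differentiable_def)
  interpret f': bounded_linear f' using f' by (rule has_derivative_bounded_linear)
  note emb = bounded_linear_slice_emb[OF I]
  have "vector_derivative (\<lambda>t. f (of_real t + I * of_real (Im z))) (at (Re z)) = f' 1"
  proof (rule vector_derivative_at)
    have "((\<lambda>t. of_real t + I * of_real (Im z)) has_derivative (\<lambda>t. of_real t)) (at (Re z))"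
      by (auto intro!: derivative_eq_intros)
    from diff_chain_at[OF this, of f f'] f'
    have "((\<lambda>t. f (of_real t + I * of_real (Im z))) has_derivative (\<lambda>t. f' (of_real t))) (at (Re z))"
      by (simp add: slice_emb_def o_def)
    then show "((\<lambda>t. f (of_real t + I * of_real (Im z))) has_vector_derivative f' 1) (at (Re z))"
      by (simp add: has_vector_derivative_def of_real_def f'.scaleR)
  qed
  moreover have "vector_derivative (\<lambda>t. f (of_real (Re z) + I * of_real t)) (at (Im z)) = f' I"
  proof (rule vector_derivative_at)
    have "((\<lambda>t. of_real (Re z) + I * of_real t) has_derivative (\<lambda>t. I * of_real t)) (at (Im z))"
      by (auto intro!: derivative_eq_intros)
    from diff_chain_at[OF this, of f f'] f'
    have "((\<lambda>t. f (of_real (Re z) + I * of_real t)) has_derivative (\<lambda>t. f' (I * of_real t))) (at (Im z))"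
      by (simp add: slice_emb_def o_def)
    then show "((\<lambda>t. f (of_real (Re z) + I * of_real t)) has_vector_derivative f' I) (at (Im z))"
      by (simp add: has_vector_derivative_def of_real_def f'.scaleR)
  qed
  moreover have "vector_derivative (\<lambda>t. f (of_real (Re z) + I * of_real (Im z))) (at (Re z)) = 0" by simp
  ultimately have "f' 1 + I * f' I = 0"
    using f I pb unfolding slice_regular_on_def slice_emb_def by metis
  then have "I * f' 1 + (I * I) * f' I = 0"
    by (metis distrib_left mult.assoc mult_zero_right)
  then have f'I: "f' I = I * f' 1" by (simp add: imag_unit_square[OF I])
  have f'h: "f' (slice_emb I h) = slice_emb I h * f' 1" for h
  proof -
    have "slice_emb I h = Re h *\<^sub>R 1 + Im h *\<^sub>R I"
      by (simp add: slice_emb_def of_real_def)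
    then show ?thesis by (simp add: f'.add f'.scaleR f'I algebra_simps)
  qed
  have "((\<lambda>z. f (slice_emb I z)) has_derivative (\<lambda>h. f' (slice_emb I h))) (at z)"
    using diff_chain_at[OF bounded_linear_imp_has_derivative[OF emb], of f f' z] f' by (simp add: o_def)
  then have "((\<lambda>z. slice_fun I (f (slice_emb I z) * v)) has_derivative
      (\<lambda>h. slice_fun I (f' (slice_emb I h) * v))) (at z)"
    by (intro bounded_linear.has_derivative[OF bounded_linear_slice_fun] has_derivative_mult_left)
  moreover have "slice_fun I (f' (slice_emb I h) * v) = slice_fun I (f' 1 * v) * h" for h
    by (simp add: f'h mult.assoc slice_fun_mult[OF I])
  ultimately have "((\<lambda>z. slice_fun I (f (slice_emb I z) * v)) has_field_derivative slice_fun I (f' 1 * v)) (at z)"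
    by (simp add: has_field_derivative_def)
  then show "(\<lambda>z. slice_fun I (f (slice_emb I z) * v)) field_differentiable at z within ball 0 1"
    using field_differentiable_at_within field_differentiable_def by blast
qed

lemma slice_fun_separates:
  assumes "\<And>v. slice_fun I (w * v) = 0"
  shows "w = 0"
proof -
  have "qRe (w * qcnj w) = 0"
    using assms[of "qcnj w"] by (simp add: slice_fun_def complex_eq_iff)
  then show ?thesis unfolding mult_qcnj quat_of_real_sel by simp
qed

text \<open>On the slice of \<open>i\<close>, a quaternion is a pair of complex numbers \<open>z\<^sub>1 + z\<^sub>2 j\<close>, and the Taylor series of
  the two components combine to a quaternionic series. It represents \<open>f\<close> on the other slices as
  well: on each of them both sides are holomorphic after applying the functionals, and they agree on
  the real segment, which is common to all slices.\<close>

lemma slice_regular_has_qseries: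
  assumes f: "slice_regular_on f qball"
  obtains F where "has_qseries f F"
proof -
  define i j where "i = Quat 0 1 0 0" and "j = Quat 0 0 1 0"
  have i: "i \<in> imag_units" by (simp add: i_def imag_units_def norm_quat_def)
  define c where "c v k = (deriv ^^ k) (\<lambda>z. slice_fun i (f (slice_emb i z) * v)) 0 / fact k" for v k
  have c: "(\<lambda>k. c v k * z ^ k) sums slice_fun i (f (slice_emb i z) * v)" if "z \<in> ball 0 1" for v z
    using holomorphic_power_series[OF slice_regular_holomorphic[OF f i] that, of v]
    by (simp add: c_def)
  define a where "a k = slice_emb i (c 1 k) + slice_emb i (c (- j) k) * j" for k
  \<comment> \<open>Right multiplication by \<open>- j\<close> moves the component \<open>z\<^sub>2\<close> to the place where the functional reads it.\<close>
  have split: "w = slice_emb i (slice_fun i (w * 1)) + slice_emb i (slice_fun i (w * (- j))) * j" for w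
    by (simp add: slice_emb_def slice_fun_def i_def j_def quat_eq_iff)
  have sums_real: "(\<lambda>k. of_real x ^ k * a k) sums f (of_real x)" if "\<bar>x\<bar> < 1" for x
  proof -
    have *: "(\<lambda>k. slice_emb i (c v k * of_real x ^ k)) sums slice_emb i (slice_fun i (f (of_real x) * v))" for v
      using bounded_linear.sums[OF bounded_linear_slice_emb[OF i] c[of "of_real x"]] that by simp
    have "(\<lambda>k. slice_emb i (c 1 k * of_real x ^ k) + slice_emb i (c (- j) k * of_real x ^ k) * j) sums f (of_real x)"
      by (subst split) (intro sums_add sums_mult2 *)
    moreover have "slice_emb i (y * of_real x ^ k) = of_real x ^ k * slice_emb i y" for y k
      using slice_emb_mult[OF i, of "of_real (x ^ k)" y] slice_emb_of_real[of i "x ^ k"]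
      by (simp add: mult.commute)
    ultimately show ?thesis by (simp add: a_def distrib_left mult.assoc)
  qed
  \<comment> \<open>Convergence on the real segment carries over to the whole ball.\<close>
  have norm_summable: "summable (\<lambda>k. r ^ k * norm (a k))" if "0 \<le> r" "r < 1" for r
    by (rule real_summable_imp_norm_summable[OF _ that]) (rule sums_summable[OF sums_real], simp)
  define g where "g p = (\<Sum>k. p ^ k * a k)" for p
  have g: "(\<lambda>k. p ^ k * a k) sums g p" if "norm p < 1" for p
    unfolding g_def by (rule summable_sums, rule summable_norm_cancel)
      (use norm_summable[of "norm p"] that in \<open>simp add: norm_mult norm_power\<close>)
  have "f p = g p" if p: "norm p < 1" for p
  proof -
    obtain I z where I: "I \<in> imag_units" and pz: "p = slice_emb I z" and "norm z = norm p"
      by (rule obtain_slice)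
    with p have z: "z \<in> ball 0 1" by simp
    have "slice_fun I ((f p - g p) * v) = 0" for v
    proof -
      have gs: "(\<lambda>k. slice_fun I (a k * v) * (z - 0) ^ k) sums slice_fun I (g (slice_emb I z) * v)"
        if "z \<in> ball 0 1" for z
      proof -
        have "(\<lambda>k. slice_emb I z ^ k * a k * v) sums (g (slice_emb I z) * v)"
          by (intro sums_mult2 g) (use that in \<open>simp add: norm_slice_emb[OF I]\<close>)
        from bounded_linear.sums[OF bounded_linear_slice_fun this, of I]
        show ?thesis
          by (simp add: slice_emb_power[OF I, symmetric] mult.assoc slice_fun_mult[OF I] mult.commute)
      qed
      let ?D = "\<lambda>z. slice_fun I (f (slice_emb I z) * v) - slice_fun I (g (slice_emb I z) * v)"
      have "?D z = 0"
      proof (rule analytic_continuation[where f = ?D and w = z and S = "ball 0 1" and U = "of_real ` {0<..<1}" and \<xi> = 0])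
        show "?D holomorphic_on ball 0 1"
          by (intro holomorphic_on_diff slice_regular_holomorphic[OF f I] power_series_holomorphic[OF gs])
        show "(0::complex) islimpt of_real ` {0<..<1}"
          unfolding islimpt_approachable
        proof (intro allI impI)
          fix e :: real assume "0 < e"
          then show "\<exists>x'\<in>complex_of_real ` {0<..<1}. x' \<noteq> 0 \<and> dist x' 0 < e"
            by (intro bexI[of _ "of_real (min e 1 / 2)"] imageI) (auto simp: min_def)
        qed
        fix z :: complex assume "z \<in> of_real ` {0<..<1}"
        then obtain x where x: "z = of_real x" "0 < x" "x < 1" by auto
        then have "f (of_real x) = g (of_real x)"
          using sums_unique2[OF sums_real g[of "of_real x"]] by simp
        then show "?D z = 0" by (simp add: x)
      qed (use z in auto)
      then show ?thesis
        using linear_diff[OF bounded_linear.linear[OF bounded_linear_slice_fun]]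
        by (simp add: pz left_diff_distrib)
    qed
    then show ?thesis using slice_fun_separates by fastforce
  qed
  then have "has_qseries f (Abs_fps a)" using g by (simp add: has_qseries_def)
  then show ?thesis by (rule that)
qed


section \<open>Multiplication by a bounded function is a contraction\<close>

lemma root_of_unity_orthogonality:
  fixes m n M :: nat
  defines "\<omega> \<equiv> exp (2 * of_real pi * \<i> / of_nat M)"
  assumes "m < M" "n < M"
  shows "(\<Sum>t<M. cnj ((\<omega> ^ t) ^ m) * (\<omega> ^ t) ^ n) = (if m = n then of_nat M else 0)"
proof -
  have M: "1 \<le> M" using assms by simp
  have \<omega>: "\<omega> ^ k = exp (2 * of_real pi * \<i> * of_nat k / of_nat M)" for k
    unfolding \<omega>_def exp_of_nat_mult[symmetric] by (simp add: mult_ac)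
  have n1: "norm \<omega> = 1" unfolding \<omega>_def by (simp add: norm_exp_eq_Re)
  then have inv: "cnj (\<omega> ^ m) * \<omega> ^ m = 1" for m
    by (metis complex_norm_square mult.commute norm_power of_real_1 power_one)
  have wM: "\<omega> ^ M = 1" using complex_root_unity[of M 1] M by (simp add: \<omega>_def)
  define \<rho> where "\<rho> = cnj (\<omega> ^ m) * \<omega> ^ n"
  have "cnj ((\<omega> ^ t) ^ m) * (\<omega> ^ t) ^ n = \<rho> ^ t" for t
    unfolding \<rho>_def by (simp add: power_mult_distrib power_mult[symmetric] mult.commute)
  then have eq: "(\<Sum>t<M. cnj ((\<omega> ^ t) ^ m) * (\<omega> ^ t) ^ n) = (\<Sum>t<M. \<rho> ^ t)" by simp
  show ?thesis
  proof (cases "m = n")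
    case True
    then have "\<rho> = 1" unfolding \<rho>_def using inv[of n] by (simp only:)
    then show ?thesis unfolding eq using True by simp
  next
    case False
    have "\<omega> ^ m * \<rho> = \<omega> ^ n" unfolding \<rho>_def using inv[of m] by (simp add: mult_ac)
    moreover have "\<omega> ^ m \<noteq> \<omega> ^ n"
      unfolding \<omega> complex_root_unity_eq[OF M] using False assms by simp
    ultimately have "\<rho> \<noteq> 1" by auto
    moreover have "\<rho> ^ M = (cnj (\<omega> ^ M)) ^ m * (\<omega> ^ M) ^ n"
      unfolding \<rho>_def by (simp add: power_mult_distrib power_mult[symmetric] mult.commute)
    then have "\<rho> ^ M = 1" by (simp add: wM)
    ultimately show ?thesis unfolding eq using False by (simp add: geometric_sum)
  qed
qed

lemma qcnj_slice_emb: "I \<in> imag_units \<Longrightarrow> qcnj (slice_emb I z) = slice_emb I (cnj z)"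
  by (simp add: quat_eq_iff slice_emb_def imag_units_def)

text \<open>Averaging over roots of unity instead of integrating over the circle keeps Parseval's identity a
  finite computation.\<close>

lemma quat_discrete_parseval:
  fixes d :: "nat \<Rightarrow> quat" and M :: nat
  defines "\<omega> \<equiv> exp (2 * of_real pi * \<i> / of_nat M)"
  assumes I: "I \<in> imag_units"
  shows "(\<Sum>t<M. (norm (\<Sum>m<M. slice_emb I (\<omega> ^ t) ^ m * d m))\<^sup>2) = real M * (\<Sum>m<M. (norm (d m))\<^sup>2)"
proof -
  interpret emb: bounded_linear "slice_emb I" by (rule bounded_linear_slice_emb[OF I])
  have *: "inner (slice_emb I (\<omega> ^ t) ^ m * d m) (slice_emb I (\<omega> ^ t) ^ n * d n) =
      inner (d m) (slice_emb I (cnj ((\<omega> ^ t) ^ m) * (\<omega> ^ t) ^ n) * d n)" for t m n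
    by (simp only: inner_mult_left_quat slice_emb_mult[OF I] slice_emb_power[OF I] qcnj_slice_emb[OF I, symmetric]
        qcnj_power mult.assoc)
  have "(\<Sum>t<M. (norm (\<Sum>m<M. slice_emb I (\<omega> ^ t) ^ m * d m))\<^sup>2) =
      (\<Sum>t<M. \<Sum>m<M. \<Sum>n<M. inner (d m) (slice_emb I (cnj ((\<omega> ^ t) ^ m) * (\<omega> ^ t) ^ n) * d n))"
    unfolding power2_norm_eq_inner inner_sum_left inner_sum_right * by (intro sum.cong refl sum.swap)
  also have "\<dots> = (\<Sum>m<M. \<Sum>n<M. \<Sum>t<M. inner (d m) (slice_emb I (cnj ((\<omega> ^ t) ^ m) * (\<omega> ^ t) ^ n) * d n))"
    by (subst sum.swap) (rule sum.cong[OF refl], rule sum.swap)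
  also have "\<dots> = (\<Sum>m<M. \<Sum>n<M. inner (d m) (slice_emb I (if m = n then of_nat M else 0) * d n))"
  proof (intro sum.cong refl)
    fix m n assume "m \<in> {..<M}" "n \<in> {..<M}"
    then have "(\<Sum>t<M. cnj ((\<omega> ^ t) ^ m) * (\<omega> ^ t) ^ n) = (if m = n then of_nat M else 0)"
      unfolding \<omega>_def by (intro root_of_unity_orthogonality) auto
    then show "(\<Sum>t<M. inner (d m) (slice_emb I (cnj ((\<omega> ^ t) ^ m) * (\<omega> ^ t) ^ n) * d n)) =
        inner (d m) (slice_emb I (if m = n then of_nat M else 0) * d n)"
      by (simp only: inner_sum_right[symmetric] sum_distrib_right[symmetric] emb.sum[symmetric])
  qed
  also have "\<dots> = (\<Sum>m<M. \<Sum>n<M. if m = n then real M * (norm (d n))\<^sup>2 else 0)"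
    by (intro sum.cong refl) (auto simp: slice_emb_scaleR power2_norm_eq_inner)
  also have "\<dots> = real M * (\<Sum>m<M. (norm (d m))\<^sup>2)"
    by (simp add: sum_distrib_left)
  finally show ?thesis .
qed

text \<open>Put \<open>h(E) = \<Sum>\<^sub>j E\<^sup>j b\<^sub>j\<close> for \<open>E\<close> on the unit circle of one slice. Then
  \<open>\<Sum>\<^sub>k E\<^sup>k h(E) a\<^sub>k = h(E) * A(h(E)\<^sup>-\<^sup>1 E h(E))\<close> for the polynomial \<open>A\<close> with coefficients \<open>a\<close>, unless \<open>h(E) = 0\<close>. The conjugated
  point may leave the slice, but it still has norm 1, so a bound for \<open>A\<close> on the whole unit sphere of the
  quaternions makes the norm of this value at most \<open>K * norm (h E)\<close>. Averaging the squares over roots of unity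
  gives the estimate for the coefficients.\<close>

lemma polynomial_coefficient_contraction:
  fixes a b :: "nat \<Rightarrow> quat"
  assumes K: "\<And>p. norm p = 1 \<Longrightarrow> norm (\<Sum>k\<le>L. p ^ k * a k) \<le> K" and NL: "N \<le> L"
  shows "(\<Sum>m\<le>N. (norm (\<Sum>j\<le>m. b j * a (m - j)))\<^sup>2) \<le> K\<^sup>2 * (\<Sum>j\<le>N. (norm (b j))\<^sup>2)"
proof -
  define I where "I = Quat 0 1 0 0"
  have I: "I \<in> imag_units" by (simp add: I_def imag_units_def norm_quat_def)
  \<comment> \<open>The product has degree at most \<open>N + L\<close>, so \<open>M\<close> points separate its coefficients.\<close>
  define M where "M = N + L + 1"
  define E where "E t = slice_emb I (exp (2 * of_real pi * \<i> / of_nat M) ^ t)" for t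
  have E: "norm (E t) = 1" for t
    unfolding E_def norm_slice_emb[OF I] by (simp add: norm_power norm_exp_eq_Re)
  have "0 \<le> K" using K[of 1] norm_ge_zero order_trans by (metis norm_one)
  define h where "h t = (\<Sum>j\<le>N. E t ^ j * b j)" for t
  define G where "G t = (\<Sum>k\<le>L. E t ^ k * h t * a k)" for t
  have le: "norm (G t) \<le> K * norm (h t)" for t
  proof (cases "h t = 0")
    case False
    have "G t = h t * (\<Sum>k\<le>L. (inverse (h t) * E t * h t) ^ k * a k)"
      unfolding G_def sum_distrib_left by (simp only: conjugate_power[OF False, symmetric] mult.assoc)
    moreover have "norm (\<Sum>k\<le>L. (inverse (h t) * E t * h t) ^ k * a k) \<le> K"
      by (rule K) (simp add: norm_conjugate[OF False] E)
    ultimately show ?thesis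
      using mult_left_mono[of _ K "norm (h t)"] by (simp add: norm_mult mult.commute[of K])
  qed (simp add: G_def)
  define S where "S = {..N} \<times> {..L}"
  define d where "d m = (\<Sum>x\<in>{x\<in>S. fst x + snd x = m}. b (fst x) * a (snd x))" for m
  \<comment> \<open>Padding with zeros, so that Parseval's identity with \<open>M\<close> points also applies to \<open>h\<close>.\<close>
  define b' where "b' j = (if j \<le> N then b j else 0)" for j
  have h: "h t = (\<Sum>m<M. E t ^ m * b' m)" for t
    unfolding h_def by (rule sum.mono_neutral_cong_left) (auto simp: M_def b'_def)
  have G: "G t = (\<Sum>m<M. E t ^ m * d m)" for t
  proof -
    have "G t = (\<Sum>k\<le>L. \<Sum>j\<le>N. E t ^ (j + k) * (b j * a k))"
      unfolding G_def h_def sum_distrib_left sum_distrib_right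
      by (simp add: power_add[symmetric] mult.assoc[symmetric] add.commute)
    also have "\<dots> = (\<Sum>x\<in>S. E t ^ (fst x + snd x) * (b (fst x) * a (snd x)))"
      unfolding S_def by (subst sum.swap) (simp add: sum.cartesian_product split_def)
    also have "\<dots> = (\<Sum>m<M. \<Sum>x\<in>{x\<in>S. fst x + snd x = m}. E t ^ (fst x + snd x) * (b (fst x) * a (snd x)))"
      by (rule sum.group[symmetric]) (auto simp: S_def M_def)
    also have "\<dots> = (\<Sum>m<M. E t ^ m * d m)"
      unfolding d_def sum_distrib_left by (intro sum.cong refl) auto
    finally show ?thesis .
  qed
  have d: "d m = (\<Sum>j\<le>m. b j * a (m - j))" if "m \<le> N" for m
    unfolding d_def S_def
    by (rule sum.reindex_bij_witness[where i = "\<lambda>j. (j, m - j)" and j = fst]) (use that NL in auto)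
  have "real M * (\<Sum>m<M. (norm (d m))\<^sup>2) = (\<Sum>t<M. (norm (G t))\<^sup>2)"
    unfolding G E_def by (rule quat_discrete_parseval[OF I, symmetric])
  also have "\<dots> \<le> (\<Sum>t<M. (K * norm (h t))\<^sup>2)"
    by (intro sum_mono power_mono le) auto
  also have "\<dots> = K\<^sup>2 * (\<Sum>t<M. (norm (h t))\<^sup>2)"
    by (simp add: power_mult_distrib sum_distrib_left)
  also have "\<dots> = K\<^sup>2 * (real M * (\<Sum>m<M. (norm (b' m))\<^sup>2))"
    unfolding h E_def quat_discrete_parseval[OF I] ..
  also have "(\<Sum>m<M. (norm (b' m))\<^sup>2) = (\<Sum>j\<le>N. (norm (b j))\<^sup>2)"
    by (rule sum.mono_neutral_cong_right) (auto simp: M_def b'_def)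
  finally have "real M * (\<Sum>m<M. (norm (d m))\<^sup>2) \<le> real M * (K\<^sup>2 * (\<Sum>j\<le>N. (norm (b j))\<^sup>2))"
    by (simp add: mult_ac)
  then have "(\<Sum>m<M. (norm (d m))\<^sup>2) \<le> K\<^sup>2 * (\<Sum>j\<le>N. (norm (b j))\<^sup>2)"
    by (simp add: M_def)
  moreover have "(\<Sum>m\<le>N. (norm (\<Sum>j\<le>m. b j * a (m - j)))\<^sup>2) = (\<Sum>m\<le>N. (norm (d m))\<^sup>2)"
    by (simp add: d)
  moreover have "(\<Sum>m\<le>N. (norm (d m))\<^sup>2) \<le> (\<Sum>m<M. (norm (d m))\<^sup>2)"
    by (rule sum_mono2) (auto simp: M_def)
  ultimately show ?thesis by simp
qed

text \<open>Multiplication by a function bounded by 1 is a contraction on square summable coefficients. The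
  polynomial estimate applies to the Taylor polynomials of \<open>p \<mapsto> f(r p)\<close>, whose bound on the unit
  sphere exceeds 1 only by the tail \<open>\<epsilon> L\<close> of the series; then \<open>L\<close> tends to infinity and \<open>r\<close> to 1.\<close>

lemma bounded_qseries_contraction:
  assumes F: "has_qseries f F" and bound: "\<And>p. norm p < 1 \<Longrightarrow> norm (f p) \<le> 1"
  shows "(\<Sum>m\<le>N. (norm (\<Sum>j\<le>m. b j * fps_nth F (m - j)))\<^sup>2) \<le> (\<Sum>j\<le>N. (norm (b j))\<^sup>2)"
    (is "?lhs \<le> ?B")
proof -
  define V where "V r = (\<Sum>m\<le>N. (norm (\<Sum>j\<le>m. b j * (r ^ (m - j) *\<^sub>R fps_nth F (m - j))))\<^sup>2)" for r :: real
  have V: "V r \<le> ?B" if r: "0 \<le> r" "r < 1" for r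
  proof -
    let ?s = "\<lambda>k. r ^ k * norm (fps_nth F k)"
    have s: "summable ?s" by (rule qseries_norm_summable[OF F r])
    define \<epsilon> where "\<epsilon> L = suminf ?s - (\<Sum>k\<le>L. ?s k)" for L
    have "\<epsilon> \<longlonglongrightarrow> suminf ?s - suminf ?s"
      unfolding \<epsilon>_def by (intro tendsto_intros summable_LIMSEQ' s)
    then have lim: "(\<lambda>L. (1 + \<epsilon> L)\<^sup>2 * ?B) \<longlonglongrightarrow> (1 + 0)\<^sup>2 * ?B"
      by (intro tendsto_intros) simp
    have "V r \<le> (1 + \<epsilon> L)\<^sup>2 * ?B" if "N \<le> L" for L
      unfolding V_def
    proof (rule polynomial_coefficient_contraction[OF _ that])
      fix p :: quat assume p: "norm p = 1"
      have "norm (of_real r * p) < 1" using r p by (simp add: norm_mult)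
      note fs = has_qseriesD[OF F this]
      have trm: "(of_real r * p) ^ k * fps_nth F k = p ^ k * (r ^ k *\<^sub>R fps_nth F k)" for k
      proof -
        have "(of_real r * p) ^ k = r ^ k *\<^sub>R p ^ k"
          by (simp add: scaleR_conv_of_real[symmetric] scaleR_power)
        then show ?thesis by simp
      qed
      let ?t = "\<lambda>k. p ^ k * (r ^ k *\<^sub>R fps_nth F k)"
      have ts: "?t sums f (of_real r * p)" using fs by (simp only: trm)
      have nt: "norm (?t k) = ?s k" for k using r by (simp add: norm_mult norm_power p)
      have "f (of_real r * p) = (\<Sum>k. ?t (k + Suc L)) + (\<Sum>k<Suc L. ?t k)"
        unfolding sums_unique[OF ts] by (rule suminf_split_initial_segment[OF sums_summable[OF ts]])
      then have "(\<Sum>k\<le>L. ?t k) = f (of_real r * p) - (\<Sum>k. ?t (k + Suc L))"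
        unfolding lessThan_Suc_atMost by simp
      moreover have "norm (\<Sum>k. ?t (k + Suc L)) \<le> (\<Sum>k. norm (?t (k + Suc L)))"
        by (rule summable_norm) (simp only: nt, rule summable_ignore_initial_segment[OF s])
      moreover have "(\<Sum>k. norm (?t (k + Suc L))) = \<epsilon> L"
        unfolding nt \<epsilon>_def suminf_minus_initial_segment[OF s, of "Suc L"] lessThan_Suc_atMost ..
      moreover have "norm (f (of_real r * p)) \<le> 1" by (rule bound) fact
      ultimately show "norm (\<Sum>k\<le>L. ?t k) \<le> 1 + \<epsilon> L"
        using norm_triangle_ineq4[of "f (of_real r * p)" "\<Sum>k. ?t (k + Suc L)"] by simp
    qed
    then have "eventually (\<lambda>L. V r \<le> (1 + \<epsilon> L)\<^sup>2 * ?B) sequentially"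
      by (auto simp: eventually_sequentially)
    from tendsto_lowerbound[OF lim this] show ?thesis by simp
  qed
  have "(V \<longlongrightarrow> V 1) (at_left 1)"
    unfolding V_def by (intro tendsto_intros)
  moreover have "eventually (\<lambda>r. V r \<le> ?B) (at_left 1)"
    using eventually_at_left_real[of 0 "1::real"] by (rule eventually_mono) (auto intro: V)
  ultimately have "V 1 \<le> ?B" by (rule tendsto_upperbound) simp
  then show ?thesis by (simp add: V_def)
qed


section \<open>The adjoint and the case of equality\<close>

text \<open>The operator taking \<open>c\<close> to \<open>d\<close> is, up to conjugation of the sequences, the adjoint of star
  multiplication by \<open>f\<close>. Reversing the order of the entries with index at most \<open>N\<close> turns its
  truncation into the lower triangular form to which the contraction estimate applies.\<close>

lemma backward_shift_contraction:
  assumes F: "has_qseries f F" and bound: "\<And>p. norm p < 1 \<Longrightarrow> norm (f p) \<le> 1"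
    and c: "summable (\<lambda>j. (norm (c j))\<^sup>2)" and d: "\<And>i. (\<lambda>k. c (i + k) * fps_nth F k) sums d i"
  shows "(\<Sum>i\<le>n. (norm (d i))\<^sup>2) \<le> (\<Sum>j. (norm (c j))\<^sup>2)"
proof -
  define e where "e N i = (\<Sum>k\<le>N - i. c (i + k) * fps_nth F k)" for N i
  have "(\<Sum>i\<le>n. (norm (e N i))\<^sup>2) \<le> (\<Sum>j. (norm (c j))\<^sup>2)" if "n \<le> N" for N
  proof -
    have "(\<Sum>i\<le>n. (norm (e N i))\<^sup>2) \<le> (\<Sum>i\<le>N. (norm (e N i))\<^sup>2)"
      by (rule sum_mono2) (use that in auto)
    also have "\<dots> = (\<Sum>m\<le>N. (norm (\<Sum>j\<le>m. c (N - j) * fps_nth F (m - j)))\<^sup>2)"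
    proof (rule sum.reindex_bij_witness[where i = "\<lambda>m. N - m" and j = "\<lambda>m. N - m"])
      fix i assume i: "i \<in> {..N}"
      have "(\<Sum>j\<le>N - i. c (N - j) * fps_nth F (N - i - j)) = e N i"
        unfolding e_def
        by (rule sum.reindex_bij_witness[where i = "\<lambda>k. N - i - k" and j = "\<lambda>k. N - i - k"]) (use i in auto)
      then show "(norm (\<Sum>j\<le>N - i. c (N - j) * fps_nth F (N - i - j)))\<^sup>2 = (norm (e N i))\<^sup>2" by simp
    qed auto
    also have "\<dots> \<le> (\<Sum>j\<le>N. (norm (c (N - j)))\<^sup>2)"
      by (rule bounded_qseries_contraction[OF F bound])
    also have "\<dots> = (\<Sum>j\<le>N. (norm (c j))\<^sup>2)"
      by (rule sum.reindex_bij_witness[where i = "\<lambda>k. N - k" and j = "\<lambda>k. N - k"]) auto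
    also have "\<dots> \<le> (\<Sum>j. (norm (c j))\<^sup>2)"
      by (rule sum_le_suminf[OF c]) auto
    finally show ?thesis .
  qed
  then have ev: "eventually (\<lambda>N. (\<Sum>i\<le>n. (norm (e N i))\<^sup>2) \<le> (\<Sum>j. (norm (c j))\<^sup>2)) sequentially"
    by (auto simp: eventually_sequentially)
  have "(\<lambda>N. e N i) \<longlonglongrightarrow> d i" for i
    unfolding e_def using filterlim_compose[OF d[of i, unfolded sums_def_le] filterlim_minus_const_nat_at_top[of i]]
    by (simp add: o_def)
  then have "(\<lambda>N. \<Sum>i\<le>n. (norm (e N i))\<^sup>2) \<longlonglongrightarrow> (\<Sum>i\<le>n. (norm (d i))\<^sup>2)"
    by (intro tendsto_intros)
  from tendsto_upperbound[OF this ev] show ?thesis by simp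
qed

lemma linear_term_vanishes:
  fixes A B C :: real
  assumes "\<And>t. 2 * t * A + t\<^sup>2 * B \<le> 2 * t * C + t\<^sup>2 * E"
  shows "A = C"
proof (rule ccontr)
  assume "A \<noteq> C"
  \<comment> \<open>At \<open>t = D / Z\<close> the linear term outweighs the quadratic one.\<close>
  define D Z where "D = A - C" and "Z = \<bar>E - B\<bar> + 1"
  have D: "D \<noteq> 0" and Z: "Z > 0" "E - B < Z" using \<open>A \<noteq> C\<close> by (auto simp: D_def Z_def)
  define t where "t = D / Z"
  have "2 * t * D \<le> t\<^sup>2 * (E - B)" using assms[of t] by (simp add: D_def algebra_simps)
  also have "\<dots> \<le> t\<^sup>2 * Z" using Z by (intro mult_left_mono) auto
  finally have "2 * (t * D) \<le> t * (t * Z)" by (simp add: power2_eq_square mult_ac)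
  then have "t * D \<le> 0" using Z by (simp add: t_def)
  moreover have "t * D = D\<^sup>2 / Z" by (simp add: t_def power2_eq_square)
  ultimately show False using D Z by (simp add: divide_le_0_iff)
qed

text \<open>A contraction \<open>T\<close> that preserves the norm of one vector \<open>c\<close> satisfies \<open>T\<^sup>* T c = c\<close>. Here
  \<open>T c = d\<close>, and conjugating entrywise, \<open>T\<^sup>*\<close> is star multiplication by \<open>f\<close>. The proof perturbs \<open>c\<close> by
  \<open>t w\<close> in the single position \<open>k\<close> and compares the terms linear in \<open>t\<close>.\<close>

lemma backward_shift_equality:
  assumes F: "has_qseries f F" and bound: "\<And>p. norm p < 1 \<Longrightarrow> norm (f p) \<le> 1"
    and c: "summable (\<lambda>j. (norm (c j))\<^sup>2)" and d: "\<And>i. (\<lambda>k. c (i + k) * fps_nth F k) sums d i"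
    and eq: "(\<lambda>i. (norm (d i))\<^sup>2) sums (\<Sum>j. (norm (c j))\<^sup>2)"
  shows "F * Abs_fps (\<lambda>i. qcnj (d i)) = Abs_fps (\<lambda>i. qcnj (c i))"
proof -
  let ?C = "\<Sum>j. (norm (c j))\<^sup>2"
  have "(\<Sum>i\<le>k. d i * qcnj (fps_nth F (k - i))) = c k" for k
  proof -
    have "inner w (\<Sum>i\<le>k. d i * qcnj (fps_nth F (k - i))) = inner w (c k)" for w
    proof -
      define u where "u i = w * fps_nth F (k - i)" for i
      define B where "B = (\<Sum>i\<le>k. (norm (u i))\<^sup>2)"
      have "(\<Sum>i\<le>k. inner (d i) (u i)) = inner w (c k)"
      proof (rule linear_term_vanishes[where B = B and E = "(norm w)\<^sup>2"])
        fix t :: real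
        define c' where "c' j = c j + (if j = k then t *\<^sub>R w else 0)" for j
        define d' where "d' i = d i + (if i \<le> k then t *\<^sub>R u i else 0)" for i
        have sq: "(norm (a + b))\<^sup>2 = (norm a)\<^sup>2 + 2 * inner a b + (norm b)\<^sup>2" for a b :: quat
          by (simp add: power2_norm_eq_inner algebra_simps inner_commute)
        have "(\<lambda>j. (norm (c j))\<^sup>2 + (if j = k then 2 * t * inner w (c k) + t\<^sup>2 * (norm w)\<^sup>2 else 0)) sums
            (?C + (2 * t * inner w (c k) + t\<^sup>2 * (norm w)\<^sup>2))"
          by (intro sums_add summable_sums[OF c] sums_single)
        moreover have "(norm (c' j))\<^sup>2 = (norm (c j))\<^sup>2 +
            (if j = k then 2 * t * inner w (c k) + t\<^sup>2 * (norm w)\<^sup>2 else 0)" for j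
          by (auto simp: c'_def sq power_mult_distrib inner_commute)
        ultimately have c': "(\<lambda>j. (norm (c' j))\<^sup>2) sums (?C + (2 * t * inner w (c k) + t\<^sup>2 * (norm w)\<^sup>2))"
          by simp
        have "(\<lambda>l. c' (i + l) * fps_nth F l) sums d' i" for i
        proof -
          have "(\<lambda>l. if l = k - i then (if i \<le> k then t *\<^sub>R u i else 0) else 0) sums (if i \<le> k then t *\<^sub>R u i else 0)"
            by (rule sums_single)
          moreover have "(if l = k - i then (if i \<le> k then t *\<^sub>R u i else 0) else 0) =
              (if i + l = k then t *\<^sub>R w else 0) * fps_nth F l" for l
            by (auto simp: u_def)
          ultimately have "(\<lambda>l. (if i + l = k then t *\<^sub>R w else 0) * fps_nth F l) sums (if i \<le> k then t *\<^sub>R u i else 0)"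
            by simp
          from sums_add[OF d this] show ?thesis
            by (simp only: c'_def d'_def distrib_right)
        qed
        from backward_shift_contraction[OF F bound sums_summable[OF c'] this]
        have bd: "(\<Sum>i\<le>n. (norm (d' i))\<^sup>2) \<le> ?C + (2 * t * inner w (c k) + t\<^sup>2 * (norm w)\<^sup>2)" for n
          by (simp only: sums_unique[OF c', symmetric])
        have "(\<Sum>i\<le>n. (norm (d' i))\<^sup>2) = (\<Sum>i\<le>n. (norm (d i))\<^sup>2) + (2 * t * (\<Sum>i\<le>k. inner (d i) (u i)) + t\<^sup>2 * B)"
          if "k \<le> n" for n
        proof -
          have "(norm (d' i))\<^sup>2 = (norm (d i))\<^sup>2 + (if i \<le> k then 2 * t * inner (d i) (u i) + t\<^sup>2 * (norm (u i))\<^sup>2 else 0)" for i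
            by (auto simp: d'_def sq power_mult_distrib)
          then have "(\<Sum>i\<le>n. (norm (d' i))\<^sup>2) = (\<Sum>i\<le>n. (norm (d i))\<^sup>2)
              + (\<Sum>i\<le>n. if i \<le> k then 2 * t * inner (d i) (u i) + t\<^sup>2 * (norm (u i))\<^sup>2 else 0)"
            by (simp only: sum.distrib)
          also have "(\<Sum>i\<le>n. if i \<le> k then 2 * t * inner (d i) (u i) + t\<^sup>2 * (norm (u i))\<^sup>2 else 0)
              = (\<Sum>i\<le>k. 2 * t * inner (d i) (u i) + t\<^sup>2 * (norm (u i))\<^sup>2)"
            by (rule sum.mono_neutral_cong_right) (use that in auto)
          finally show ?thesis by (simp add: B_def sum.distrib sum_distrib_left)
        qed
        then have "\<exists>N. \<forall>n\<ge>N. (\<Sum>i\<le>n. (norm (d i))\<^sup>2) \<le>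
            ?C + (2 * t * inner w (c k) + t\<^sup>2 * (norm w)\<^sup>2) - (2 * t * (\<Sum>i\<le>k. inner (d i) (u i)) + t\<^sup>2 * B)"
          using bd by (metis (no_types, lifting) le_diff_eq)
        from LIMSEQ_le_const2[OF eq[unfolded sums_def_le] this]
        show "2 * t * (\<Sum>i\<le>k. inner (d i) (u i)) + t\<^sup>2 * B \<le> 2 * t * inner w (c k) + t\<^sup>2 * (norm w)\<^sup>2"
          by simp
      qed
      moreover have "inner (d i) (u i) = inner w (d i * qcnj (fps_nth F (k - i)))" for i
        unfolding u_def by (subst inner_commute) (rule inner_mult_right_quat)
      ultimately show ?thesis by (simp add: inner_sum_right)
    qed
    then show ?thesis by (metis inner_commute vector_eq_rdot)
  qed
  then have "qcnj (c k) = (\<Sum>i\<le>k. fps_nth F (k - i) * qcnj (d i))" for k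
    by (metis (no_types, lifting) qcnj_simps(3,5) qcnj_sum sum.cong)
  moreover have "(\<Sum>i\<le>k. fps_nth F (k - i) * qcnj (d i)) = (\<Sum>i=0..k. fps_nth F i * qcnj (d (k - i)))" for k
    by (rule sum.reindex_bij_witness[where i = "\<lambda>i. k - i" and j = "\<lambda>i. k - i"]) auto
  ultimately show ?thesis by (simp add: fps_eq_iff fps_mult_nth)
qed


section \<open>The interpolation data\<close>

lemma summable_norm_power2_exponential_sum:
  fixes u v p :: "'n::finite \<Rightarrow> quat"
  assumes p: "\<And>i. norm (p i) < 1"
  shows "summable (\<lambda>k. (norm (\<Sum>i\<in>UNIV. u i * p i ^ k * v i))\<^sup>2)"
proof -
  define e where "e k = (\<Sum>i\<in>UNIV. norm (u i) * norm (p i) ^ k * norm (v i))" for k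
  have e: "summable e"
    unfolding e_def by (intro summable_sum summable_mult summable_mult2 summable_geometric) (simp add: p)
  have "norm ((norm (\<Sum>i\<in>UNIV. u i * p i ^ k * v i))\<^sup>2) \<le> e 0 * e k" for k
  proof -
    have n: "norm (\<Sum>i\<in>UNIV. u i * p i ^ k * v i) \<le> e k"
      unfolding e_def by (rule order_trans[OF norm_sum]) (simp add: norm_mult norm_power)
    have e0: "e k \<le> e 0"
      unfolding e_def
      by (intro sum_mono mult_right_mono mult_left_mono) (auto intro!: power_le_one less_imp_le[OF p])
    have "norm (\<Sum>i\<in>UNIV. u i * p i ^ k * v i) * norm (\<Sum>i\<in>UNIV. u i * p i ^ k * v i) \<le> e 0 * e k"
      by (rule mult_mono) (use n e0 order_trans[OF norm_ge_zero n] in auto)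
    then show ?thesis by (simp add: power2_eq_square)
  qed
  then show ?thesis by (rule summable_comparison_test'[OF summable_mult[OF e], of 0])
qed

lemma pick_matrix_nth_sums:
  fixes p s :: "'n::finite \<Rightarrow> quat"
  assumes p: "\<And>i. norm (p i) < 1"
  shows "(\<lambda>k. p i ^ k * (1 - s i * qcnj (s j)) * qcnj (p j) ^ k) sums vec_nth (vec_nth (pick_matrix p s) i) j"
proof -
  have "norm (p i) * norm (p j) < 1"
    using p[of i] p[of j] by (metis less_imp_le mult_le_one norm_ge_zero not_less mult_left_le order_le_less_trans)
  then have "summable (\<lambda>k. norm (1 - s i * qcnj (s j)) * (norm (p i) * norm (p j)) ^ k)"
    by (intro summable_mult summable_geometric) (simp add: abs_mult)
  then have "summable (\<lambda>k. norm (p i ^ k * (1 - s i * qcnj (s j)) * qcnj (p j) ^ k))"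
    by (simp add: norm_mult norm_power power_mult_distrib mult_ac)
  then show ?thesis
    unfolding pick_matrix_def by (simp add: summable_norm_cancel summable_sums)
qed

text \<open>The value of the Pick form at \<open>y\<close> is the loss of squared norm from the sequence \<open>\<Sum>\<^sub>i cnj(y\<^sub>i) p\<^sub>i\<^sup>k\<close> to
  the sequence \<open>\<Sum>\<^sub>i cnj(y\<^sub>i) p\<^sub>i\<^sup>k s\<^sub>i\<close>. A kernel vector of the Pick matrix therefore makes the two norms
  equal.\<close>

lemma pick_matrix_quadratic_form:
  fixes p s :: "'n::finite \<Rightarrow> quat"
  assumes p: "\<And>i. norm (p i) < 1"
  shows "(\<lambda>k. (norm (\<Sum>i\<in>UNIV. qcnj (vec_nth y i) * p i ^ k))\<^sup>2 - (norm (\<Sum>i\<in>UNIV. qcnj (vec_nth y i) * p i ^ k * s i))\<^sup>2)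
      sums qRe (\<Sum>i\<in>UNIV. qcnj (vec_nth y i) * vec_nth (pick_matrix p s *v y) i)"
proof -
  let ?c = "\<lambda>k. \<Sum>i\<in>UNIV. qcnj (vec_nth y i) * p i ^ k"
  let ?d = "\<lambda>k. \<Sum>i\<in>UNIV. qcnj (vec_nth y i) * p i ^ k * s i"
  have "(\<lambda>k. \<Sum>i\<in>UNIV. qcnj (vec_nth y i) * (\<Sum>j\<in>UNIV. p i ^ k * (1 - s i * qcnj (s j)) * qcnj (p j) ^ k * vec_nth y j))
      sums (\<Sum>i\<in>UNIV. qcnj (vec_nth y i) * vec_nth (pick_matrix p s *v y) i)"
    unfolding matrix_vector_mult_def vec_lambda_beta
    by (intro sums_sum sums_mult sums_mult2 pick_matrix_nth_sums p)
  moreover have "(\<Sum>i\<in>UNIV. qcnj (vec_nth y i) * (\<Sum>j\<in>UNIV. p i ^ k * (1 - s i * qcnj (s j)) * qcnj (p j) ^ k * vec_nth y j))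
      = of_real ((norm (?c k))\<^sup>2 - (norm (?d k))\<^sup>2)" for k
  proof -
    have "of_real ((norm (?c k))\<^sup>2 - (norm (?d k))\<^sup>2) = ?c k * qcnj (?c k) - ?d k * qcnj (?d k)"
      by (simp add: mult_qcnj)
    also have "\<dots> = (\<Sum>i\<in>UNIV. \<Sum>j\<in>UNIV. (qcnj (vec_nth y i) * p i ^ k) * (qcnj (p j) ^ k * vec_nth y j)
        - (qcnj (vec_nth y i) * p i ^ k * s i) * (qcnj (s j) * (qcnj (p j) ^ k * vec_nth y j)))"
      unfolding qcnj_sum sum_product by (simp add: sum_subtractf)
    also have "\<dots> = (\<Sum>i\<in>UNIV. qcnj (vec_nth y i) * (\<Sum>j\<in>UNIV. p i ^ k * (1 - s i * qcnj (s j)) * qcnj (p j) ^ k * vec_nth y j))"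
      unfolding sum_distrib_left by (intro sum.cong refl) (simp add: algebra_simps)
    finally show ?thesis ..
  qed
  ultimately have "(\<lambda>k. of_real ((norm (?c k))\<^sup>2 - (norm (?d k))\<^sup>2)) sums (\<Sum>i\<in>UNIV. qcnj (vec_nth y i) * vec_nth (pick_matrix p s *v y) i)"
    by simp
  from bounded_linear.sums[OF bounded_linear_qRe this] show ?thesis
    by (simp only: quat_of_real_sel)
qed

lemma k_H2_sums:
  assumes "norm z < 1" "norm q < 1"
  shows "(\<lambda>m. z ^ m * qcnj q ^ m) sums k_H2 z q"
proof -
  have "norm z * norm q < 1"
    using assms by (metis mult_left_le order_le_less_trans less_imp_le norm_ge_zero)
  then have "summable (\<lambda>m. (norm z * norm q) ^ m)" by (intro summable_geometric) (simp add: abs_mult)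
  then have "summable (\<lambda>m. norm (z ^ m * qcnj q ^ m))"
    by (simp add: norm_mult norm_power power_mult_distrib)
  then show ?thesis unfolding k_H2_def by (simp add: summable_norm_cancel summable_sums)
qed

lemma has_qseries_R_fun:
  fixes p :: "'n::finite \<Rightarrow> quat"
  assumes p: "\<And>i. norm (p i) < 1"
  shows "has_qseries (R_fun p y) (Abs_fps (\<lambda>k. qcnj (\<Sum>i\<in>UNIV. qcnj (vec_nth y i) * p i ^ k)))"
  unfolding has_qseries_def
proof
  fix z assume "z \<in> qball"
  then have "(\<lambda>k. \<Sum>i\<in>UNIV. z ^ k * qcnj (p i) ^ k * vec_nth y i) sums R_fun p y z"
    unfolding R_fun_def by (intro sums_sum sums_mult2 k_H2_sums p) simp
  then show "(\<lambda>k. z ^ k * fps_nth (Abs_fps (\<lambda>k. qcnj (\<Sum>i\<in>UNIV. qcnj (vec_nth y i) * p i ^ k))) k) sums R_fun p y z"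
    by (simp add: qcnj_sum sum_distrib_left mult.assoc)
qed

text \<open>Conjugating \<open>p\<^sub>i\<close> by \<open>s\<^sub>i\<close> in the kernel only serves to move \<open>cnj(s\<^sub>i)\<close> to the left of the power of
  \<open>cnj(p\<^sub>i)\<close>. In this form the nodes with \<open>s\<^sub>i = 0\<close> contribute zero and can be included.\<close>

lemma has_qseries_Q_fun:
  fixes p s :: "'n::finite \<Rightarrow> quat"
  assumes p: "\<And>i. norm (p i) < 1"
  shows "has_qseries (Q_fun p s y) (Abs_fps (\<lambda>k. qcnj (\<Sum>i\<in>UNIV. qcnj (vec_nth y i) * p i ^ k * s i)))"
  unfolding has_qseries_def
proof
  fix z assume z: "z \<in> qball"
  define q where "q i = inverse (s i) * p i * s i" for i
  have "(\<lambda>k. \<Sum>i | s i \<noteq> 0. z ^ k * qcnj (q i) ^ k * qcnj (s i) * vec_nth y i) sums Q_fun p s y z"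
    unfolding Q_fun_def q_def[symmetric] using z p
    by (intro sums_sum sums_mult2 k_H2_sums) (auto simp: q_def norm_conjugate)
  moreover have "(\<Sum>i | s i \<noteq> 0. z ^ k * qcnj (q i) ^ k * qcnj (s i) * vec_nth y i) =
      z ^ k * qcnj (\<Sum>i\<in>UNIV. qcnj (vec_nth y i) * p i ^ k * s i)" for k
  proof -
    have "qcnj (q i) ^ k * qcnj (s i) = qcnj (p i ^ k * s i)" if "s i \<noteq> 0" for i
      unfolding q_def conjugate_power[OF that, symmetric] by (simp only: qcnj_power qcnj_simps(5))
    then have "(\<Sum>i | s i \<noteq> 0. z ^ k * qcnj (q i) ^ k * qcnj (s i) * vec_nth y i) =
        (\<Sum>i | s i \<noteq> 0. z ^ k * (qcnj (p i ^ k * s i) * vec_nth y i))"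
      by (intro sum.cong refl) (simp add: mult.assoc[symmetric] del: qcnj_simps, metis mult.assoc)
    also have "\<dots> = (\<Sum>i\<in>UNIV. z ^ k * (qcnj (p i ^ k * s i) * vec_nth y i))"
      by (rule sum.mono_neutral_left) auto
    finally show ?thesis by (simp add: qcnj_sum sum_distrib_left mult.assoc)
  qed
  ultimately show "(\<lambda>k. z ^ k * fps_nth (Abs_fps (\<lambda>k. qcnj (\<Sum>i\<in>UNIV. qcnj (vec_nth y i) * p i ^ k * s i))) k) sums Q_fun p s y z"
    by simp
qed

text \<open>A quaternionic matrix with trivial kernel is an injective real linear map of a
  finite-dimensional space, hence surjective. Solving for the unit
  vectors yields a right inverse, which injectivity makes two-sided.\<close>

lemma not_invertible_obtains_kernel:
  fixes A :: "quat^'n^'n"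
  assumes "\<not> invertible A"
  obtains y where "y \<noteq> 0" "A *v y = 0"
proof (rule ccontr)
  assume "\<not> thesis"
  with that have ker: "y = 0" if "A *v y = 0" for y using that by blast
  have lin: "linear ((*v) A)"
    by (rule linearI) (simp_all add: vec_eq_iff matrix_vector_mult_def algebra_simps sum.distrib scaleR_sum_right)
  then have inj: "inj ((*v) A)" using ker by (simp add: linear_injective_0)
  then have "surj ((*v) A)" by (simp add: lin linear_injective_imp_surjective)
  then have "\<exists>x. A *v x = column j (mat 1)" for j by (metis surjD)
  then obtain X where X: "\<And>j. A *v X j = column j (mat 1)" by metis
  define B :: "quat^'n^'n" where "B = (\<chi> i j. vec_nth (X j) i)"
  have col: "column j (M ** N) = M *v column j N" for j and M N :: "quat^'n^'n"
    by (simp add: vec_eq_iff column_def matrix_matrix_mult_def matrix_vector_mult_def)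
  have eqI: "M = N" if "\<And>j. column j M = column j N" for M N :: "quat^'n^'n"
    using that by (simp add: vec_eq_iff column_def)
  have "column j B = X j" for j by (simp add: B_def column_def vec_eq_iff)
  then have AB: "A ** B = mat 1" by (intro eqI) (simp add: col X)
  then have "A ** (B ** A) = A ** mat 1" by (simp add: matrix_mul_assoc)
  then have "A *v column j (B ** A) = A *v column j (mat 1)" for j by (metis col)
  then have "column j (B ** A) = column j (mat 1)" for j using inj by (meson injD)
  then have "B ** A = mat 1" by (rule eqI)
  with AB assms show False by (auto simp: invertible_def)
qed


section \<open>Star quotients\<close>

text \<open>A series with real coefficients preserves each slice and is there the same complex power series
  \<open>H\<close> on all of them. The zeros of \<open>H\<close> are isolated, as the identity theorem shows.\<close>

lemma real_qseries_zeros_nowhere_dense: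
  assumes F: "has_qseries f F" and real: "\<And>k. fps_nth F k \<in> \<real>" and "F \<noteq> 0" and p: "norm p < 1"
  shows "p islimpt {q \<in> qball. f q \<noteq> 0}"
proof (rule ccontr)
  assume no: "\<not> p islimpt {q \<in> qball. f q \<noteq> 0}"
  have F_eq: "fps_nth F k = of_real (qRe (fps_nth F k))" for k
    using real[of k] by (auto elim: Reals_cases)
  define H :: "complex \<Rightarrow> complex" where "H z = (\<Sum>k. of_real (qRe (fps_nth F k)) * z ^ k)" for z
  have H: "(\<lambda>k. of_real (qRe (fps_nth F k)) * z ^ k) sums H z" if "norm z < 1" for z
  proof -
    have "summable (\<lambda>k. norm z ^ k * norm (fps_nth F k))" by (rule qseries_norm_summable[OF F]) (use that in auto)
    moreover have "norm (fps_nth F k) = \<bar>qRe (fps_nth F k)\<bar>" for k by (subst F_eq) (rule norm_of_real)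
    ultimately have "summable (\<lambda>k. norm (of_real (qRe (fps_nth F k)) * z ^ k))"
      by (simp add: norm_mult norm_power mult.commute)
    then show ?thesis unfolding H_def by (simp add: summable_norm_cancel summable_sums)
  qed
  have fH: "f (slice_emb I z) = slice_emb I (H z)" if I: "I \<in> imag_units" and z: "norm z < 1" for I z
  proof -
    have s1: "(\<lambda>k. slice_emb I (of_real (qRe (fps_nth F k)) * z ^ k)) sums slice_emb I (H z)"
      by (rule bounded_linear.sums[OF bounded_linear_slice_emb[OF I] H[OF z]])
    have eq: "slice_emb I (of_real (qRe (fps_nth F k)) * z ^ k) = slice_emb I z ^ k * fps_nth F k" for k
      unfolding slice_emb_mult[OF I] slice_emb_power[OF I] slice_emb_of_real F_eq[symmetric]
      by (subst (1 2) F_eq) (rule quat_of_real_commute)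
    have s2: "(\<lambda>k. slice_emb I z ^ k * fps_nth F k) sums f (slice_emb I z)"
      by (rule has_qseriesD[OF F]) (simp add: norm_slice_emb[OF I] z)
    show ?thesis using sums_unique2[OF s1[unfolded eq] s2] by simp
  qed
  have emb0: "slice_emb I w = 0 \<longleftrightarrow> w = 0" if "I \<in> imag_units" for I w
    using norm_slice_emb[OF that, of w] by auto
  obtain I z where I: "I \<in> imag_units" and pz: "p = slice_emb I z" and "norm z = norm p"
    by (rule obtain_slice)
  with p have z: "norm z < 1" by simp
  from no obtain e where e: "e > 0"
      "\<And>q. q \<in> {q \<in> qball. f q \<noteq> 0} \<Longrightarrow> \<not> (q \<noteq> p \<and> dist q p < e)"
    unfolding islimpt_approachable by blast
  have "H w = 0" if w: "norm w < 1" for w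
  proof (rule analytic_continuation[where f = H and w = w and S = "ball 0 1" and U = "ball 0 1 \<inter> ball z e - {z}" and \<xi> = z])
    show "H holomorphic_on ball 0 1"
      by (rule power_series_holomorphic[of 0 1 "\<lambda>k. of_real (qRe (fps_nth F k))"]) (use H in simp)
    have "z islimpt ball 0 1 \<inter> ball z e"
      by (rule open_imp_islimpt) (use z e(1) in auto)
    then show "z islimpt ball 0 1 \<inter> ball z e - {z}" unfolding islimpt_def by blast
    fix w assume w: "w \<in> ball 0 1 \<inter> ball z e - {z}"
    have "slice_emb I w - p = slice_emb I (w - z)"
      by (simp add: pz slice_emb_scaleR algebra_simps)
    then have "norm (slice_emb I w - p) = norm (w - z)" by (simp add: norm_slice_emb[OF I])
    then have "dist (slice_emb I w) p = dist w z" by (simp add: dist_norm)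
    moreover from this w have "slice_emb I w \<noteq> p" by auto
    ultimately have "f (slice_emb I w) = 0"
      using w e(2)[of "slice_emb I w"] by (auto simp: norm_slice_emb[OF I] dist_commute)
    with w show "H w = 0" by (simp add: fH[OF I] emb0[OF I])
  qed (use z w in auto)
  then have "f q = 0" if "norm q < 1" for q
    using obtain_slice[of q] fH emb0 that by metis
  then have "has_qseries f 0"
    by (simp add: has_qseries_def)
  with \<open>F \<noteq> 0\<close> qseries_unique[OF F] show False by blast
qed

text \<open>Multiplying \<open>S \<star> Q = R\<close> by the conjugate \<open>Q\<^sup>c\<close> from the right gives \<open>R \<star> Q\<^sup>c = S \<star> N\<close> with
  \<open>N = Q\<^sup>c \<star> Q\<close>. As \<open>N\<close> has real coefficients, the right-hand side at \<open>p\<close> is \<open>N(p) * S(p)\<close>, and dividing by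
  \<open>N(p)\<close> gives the quotient formula. The pointwise star product evaluates \<open>N\<close> at the conjugated point
  \<open>R(p)\<^sup>-\<^sup>1 p R(p)\<close> instead of \<open>p\<close>, where its value is the conjugate \<open>R(p)\<^sup>-\<^sup>1 N(p) R(p)\<close>. At the zeros
  of \<open>N\<close> the formula holds in the limit, by continuity of \<open>S\<close>.\<close>

lemma is_star_quotient_of_factorization:
  assumes S: "has_qseries S F" and R: "has_qseries R C" and Q: "has_qseries Q D"
    and fac: "F * D = C" and "D \<noteq> 0" and cont: "continuous_on qball S"
  shows "is_star_quotient S R Q"
proof -
  let ?Qc = "regular_conj Q" and ?N = "star (regular_conj Q) Q"
  note Qc = has_qseries_regular_conj[OF Q]
  note N = has_qseries_star[OF Qc Q]
  have "D \<noteq> 0 \<Longrightarrow> fps_qcnj D \<noteq> 0" by (auto simp: fps_eq_iff fps_qcnj_def)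
  with \<open>D \<noteq> 0\<close> have N0: "fps_qcnj D * D \<noteq> 0" by simp
  have quot: "S p = star_pointwise R (star_inverse Q) p" if p: "p \<in> star_inverse_dom Q" for p
  proof -
    have p1: "norm p < 1" and Np: "?N p \<noteq> 0" using p by (auto simp: star_inverse_dom_def)
    have "C * fps_qcnj D = F * (fps_qcnj D * D)"
      by (simp add: fac[symmetric] mult.assoc fps_qcnj_times_self(1))
    then have "star R ?Qc p = star S ?N p"
      using sums_unique2[OF has_qseriesD[OF has_qseries_star[OF R Qc] p1]] has_qseriesD[OF has_qseries_star[OF S N] p1]
      by simp
    then have eq: "star_pointwise R ?Qc p = ?N p * S p"
      by (simp add: star_eq_star_pointwise[OF R Qc p1] star_real_coeffs[OF S N p1 fps_qcnj_times_self(2)])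
    show ?thesis
    proof (cases "R p = 0")
      case True
      with eq Np show ?thesis by (simp add: star_pointwise_def)
    next
      case False
      define p' where "p' = inverse (R p) * p * R p"
      have p': "norm p' < 1" using p1 by (simp add: p'_def norm_conjugate[OF False])
      have s1: "(\<lambda>k. R p * (p' ^ k * fps_nth (fps_qcnj D * D) k)) sums (R p * ?N p')"
        by (intro sums_mult has_qseriesD[OF N p'])
      have eq': "R p * (p' ^ k * fps_nth (fps_qcnj D * D) k) = p ^ k * fps_nth (fps_qcnj D * D) k * R p" for k
      proof -
        have "R p * fps_nth (fps_qcnj D * D) k = fps_nth (fps_qcnj D * D) k * R p"
          using fps_qcnj_times_self(2)[of D k] by (metis Reals_cases quat_of_real_commute)
        then show ?thesis
          unfolding mult.assoc[symmetric] p'_def conjugate_power[OF False] by (simp only: mult.assoc)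
      qed
      have s2: "(\<lambda>k. p ^ k * fps_nth (fps_qcnj D * D) k * R p) sums (?N p * R p)"
        by (intro sums_mult2 has_qseriesD[OF N p1])
      have RN: "R p * ?N p' = ?N p * R p" by (rule sums_unique2[OF s1[unfolded eq'] s2])
      then have "?N p' \<noteq> 0" using Np False by auto
      have "R p * inverse (?N p') = inverse (?N p) * (?N p * R p) * inverse (?N p')"
        using Np by (simp only: mult.assoc[symmetric] left_inverse mult_1 not_False_eq_True)
      also have "\<dots> = inverse (?N p) * R p"
        unfolding RN[symmetric] using \<open>?N p' \<noteq> 0\<close> by (simp only: mult.assoc right_inverse mult_1_right not_False_eq_True)
      finally have RN': "R p * inverse (?N p') = inverse (?N p) * R p" .
      have "star_pointwise R (star_inverse Q) p = R p * inverse (?N p') * ?Qc p'"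
        using False by (simp add: star_pointwise_def star_inverse_def p'_def mult.assoc)
      also have "\<dots> = inverse (?N p) * star_pointwise R ?Qc p"
        unfolding RN' using False by (simp add: star_pointwise_def p'_def mult.assoc)
      also have "\<dots> = S p"
        unfolding eq mult.assoc[symmetric] left_inverse[OF Np] by simp
      finally show ?thesis ..
    qed
  qed
  show ?thesis
    unfolding is_star_quotient_def
  proof (intro conjI ballI)
    show "\<exists>p\<in>qball. Q p \<noteq> 0"
    proof (rule ccontr)
      assume "\<not> ?thesis"
      then have "has_qseries Q 0" by (simp add: has_qseries_def)
      with \<open>D \<noteq> 0\<close> qseries_unique[OF Q] show False by blast
    qed
    show "S p = star_pointwise R (star_inverse Q) p" if "p \<in> star_inverse_dom Q" for p
      by (rule quot) fact
    fix p assume "p \<in> qball - star_inverse_dom Q"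
    then have p: "p \<in> qball" by simp
    show "p islimpt star_inverse_dom Q"
      unfolding star_inverse_dom_def
      by (rule real_qseries_zeros_nowhere_dense[OF N fps_qcnj_times_self(2) N0]) (use p in simp)
    have "(S \<longlongrightarrow> S p) (at p within qball)"
      using cont p unfolding continuous_on_def by (rule bspec)
    then have "(S \<longlongrightarrow> S p) (at p within star_inverse_dom Q)"
      by (rule tendsto_within_subset) (auto simp: star_inverse_dom_def)
    then show "(star_pointwise R (star_inverse Q) \<longlongrightarrow> S p) (at p within star_inverse_dom Q)"
      by (rule Lim_transform_within[of _ _ _ _ 1]) (auto simp: quot)
  qed
qed


section \<open>Interpolation with a singular Pick matrix\<close>

text \<open>The interpolation conditions make the adjoint of multiplication by \<open>S\<close> take the (conjugated)
  coefficients of \<open>R\<close> to those of \<open>Q\<close>. Since \<open>y\<close> lies in the kernel, no norm is lost, which forces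
  \<open>S \<star> Q = R\<close>. In particular \<open>Q = 0\<close> would give \<open>R = 0\<close> and then \<open>y = 0\<close>, as the nodes are independent.\<close>

lemma interpolant_factorization:
  fixes p s :: "'n::finite \<Rightarrow> quat"
  assumes p: "\<And>i. norm (p i) < 1" and "inj p"
    and three: "\<not> (\<exists>i j k q. i \<noteq> j \<and> j \<noteq> k \<and> i \<noteq> k \<and> {p i, p j, p k} \<subseteq> two_sphere q)"
    and S: "has_qseries S F" and bound: "\<And>z. norm z < 1 \<Longrightarrow> norm (S z) \<le> 1" and interp: "\<And>i. S (p i) = s i"
    and y: "y \<noteq> 0" "pick_matrix p s *v y = 0"
  defines "C \<equiv> Abs_fps (\<lambda>k. qcnj (\<Sum>i\<in>UNIV. qcnj (vec_nth y i) * p i ^ k))"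
    and "D \<equiv> Abs_fps (\<lambda>k. qcnj (\<Sum>i\<in>UNIV. qcnj (vec_nth y i) * p i ^ k * s i))"
  shows "F * D = C" and "D \<noteq> 0"
proof -
  let ?c = "\<lambda>k. \<Sum>i\<in>UNIV. qcnj (vec_nth y i) * p i ^ k"
  let ?d = "\<lambda>k. \<Sum>i\<in>UNIV. qcnj (vec_nth y i) * p i ^ k * s i"
  have c: "summable (\<lambda>k. (norm (?c k))\<^sup>2)"
    using summable_norm_power2_exponential_sum[where p = p and u = "\<lambda>i. qcnj (vec_nth y i)" and v = "\<lambda>_. 1", OF p] by simp
  have "(\<lambda>k. (norm (?c k))\<^sup>2 - (norm (?d k))\<^sup>2) sums 0"
    using pick_matrix_quadratic_form[where p = p and y = y and s = s, OF p] y(2) by simp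
  from sums_diff[OF summable_sums[OF c] this]
  have dc: "(\<lambda>k. (norm (?d k))\<^sup>2) sums (\<Sum>k. (norm (?c k))\<^sup>2)" by simp
  have "(\<lambda>k. ?c (i + k) * fps_nth F k) sums ?d i" for i
  proof -
    have "(\<lambda>k. \<Sum>l\<in>UNIV. qcnj (vec_nth y l) * p l ^ i * (p l ^ k * fps_nth F k)) sums
        (\<Sum>l\<in>UNIV. qcnj (vec_nth y l) * p l ^ i * s l)"
      using has_qseriesD[OF S p] by (intro sums_sum sums_mult) (simp add: interp)
    then show ?thesis by (simp add: sum_distrib_right power_add mult.assoc)
  qed
  from backward_shift_equality[OF S bound c this dc]
  show FDC: "F * D = C" by (simp add: C_def D_def)
  show "D \<noteq> 0"
  proof
    assume "D = 0"
    with FDC have C: "C = 0" by simp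
    have "qcnj (?c k) = 0" for k
      using C unfolding C_def by (metis fps_nth_Abs_fps fps_zero_nth)
    then have zero: "?c k = 0" for k by (metis qcnj_eq_0_iff)
    have "qcnj (vec_nth y a) = 0" for a
    proof (rule quat_vandermonde[where A = UNIV and p = p and x = "\<lambda>i. qcnj (vec_nth y i)"])
      show "\<not> {p i, p j, p k} \<subseteq> two_sphere (p i)" if "i \<noteq> j" "j \<noteq> k" "i \<noteq> k" for i j k
        using three that by blast
    qed (use \<open>inj p\<close> zero in auto)
    with y(1) show False by (simp add: vec_eq_iff)
  qed
qed

theorem lemma4p6:
  fixes p s :: "'n::finite \<Rightarrow> quat"
  assumes "\<And>i. p i \<in> qball"
    and "inj p"
    and "\<not> (\<exists>i j k q. i \<noteq> j \<and> j \<noteq> k \<and> i \<noteq> k \<and> {p i, p j, p k} \<subseteq> two_sphere q)"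
    and "psd (pick_matrix p s)"
    and "\<not> invertible (pick_matrix p s)"
  shows "(\<forall>S T. interpolates p s S \<and> interpolates p s T \<longrightarrow> (\<forall>z\<in>qball. S z = T z)) \<and>
    (\<forall>S y. interpolates p s S \<and> y \<noteq> 0 \<and> pick_matrix p s *v y = 0 \<longrightarrow>
       is_star_quotient S (R_fun p y) (Q_fun p s y))"
proof -
  have p: "norm (p i) < 1" for i using assms(1)[of i] by simp
  define C D where "C y = Abs_fps (\<lambda>k. qcnj (\<Sum>i\<in>UNIV. qcnj (vec_nth y i) * p i ^ k))"
    and "D y = Abs_fps (\<lambda>k. qcnj (\<Sum>i\<in>UNIV. qcnj (vec_nth y i) * p i ^ k * s i))" for y
  have factor: "\<exists>F. has_qseries S F \<and> (\<forall>y. y \<noteq> 0 \<longrightarrow> pick_matrix p s *v y = 0 \<longrightarrow> F * D y = C y \<and> D y \<noteq> 0)"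
    if S: "interpolates p s S" for S
  proof -
    have "slice_regular_on S qball" using S by (simp add: interpolates_def schur_class_def)
    then obtain F where F: "has_qseries S F" by (rule slice_regular_has_qseries)
    have "F * D y = C y \<and> D y \<noteq> 0" if "y \<noteq> 0" "pick_matrix p s *v y = 0" for y
      unfolding C_def D_def
      using interpolant_factorization[OF p assms(2,3) F _ _ that] S
      by (auto simp: interpolates_def schur_class_def)
    with F show ?thesis by blast
  qed
  show ?thesis
  proof (intro conjI allI impI ballI; elim conjE)
    fix S T z assume S: "interpolates p s S" and T: "interpolates p s T" and z: "z \<in> qball"
    obtain y where y: "y \<noteq> 0" "pick_matrix p s *v y = 0"
      by (rule not_invertible_obtains_kernel[OF assms(5)])
    obtain F G where F: "has_qseries S F" "F * D y = C y" "D y \<noteq> 0"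
      and G: "has_qseries T G" "G * D y = C y"
      using factor[OF S] factor[OF T] y by blast
    have "(F - G) * D y = 0" using F G by (simp add: left_diff_distrib)
    with F(3) have "F = G" by simp
    with z F(1) G(1) show "S z = T z" unfolding has_qseries_def using sums_unique2 by blast
  next
    fix S y assume S: "interpolates p s S" and y: "y \<noteq> 0" "pick_matrix p s *v y = 0"
    obtain F where F: "has_qseries S F" "F * D y = C y" "D y \<noteq> 0"
      using factor[OF S] y by blast
    have "continuous_on qball S"
      using S unfolding interpolates_def schur_class_def slice_regular_on_def
      by (auto intro: differentiable_imp_continuous_on)
    then show "is_star_quotient S (R_fun p y) (Q_fun p s y)"
      by (rule is_star_quotient_of_factorization[OF F(1) has_qseries_R_fun[OF p]
          has_qseries_Q_fun[OF p] F(2,3)[unfolded C_def D_def]])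
  qed
qed

end
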